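(* Let $\mu$ be a Borel measure on $\mathbb R$ with $\mu(\mathbb R)=1$. Let $f\in C^1(\mathbb R)$ be Lipschitz continuous on $\mathbb R$ and suppose there is a constant $\alpha\in(0,1)$ with $f(0)=f(\alpha)=f(1)=0$, $f<0$ on $(0,\alpha)$ and $f>0$ on $(\alpha,1)$. Suppose $f'(\alpha)>0$. Then there exist a constant $c\in\mathbb R$ and a monotone function $\phi$ on $\mathbb R$ with $\phi(-\infty)=0$ and $\phi(+\infty)=1$ such that $u(t,x):=\phi(x+ct)$ is a solution to \[u_t=\mu*u-u+f(u).\]
   Context: The convolution is $(\mu*u)(x)=\int_{y\in\mathbb R}u(x-y)\,d\mu(y)$ for bounded Borel-measurable $u$. The map $u\mapsto \mu*u-u+f(u)$ is Lipschitz from $L^\infty(\mathbb R)$ to $L^\infty(\mathbb R)$, so the equation generates a flow on $L^\infty(\mathbb R)$; "solution" refers to solutions of this ODE in $L^\infty(\mathbb R)$. The measure $\mu$ need not be absolutely continuous with respect to Lebesgue measure. *)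

theory Defs
  imports "HOL-Probability.Probability"
begin

definition conv :: "real measure \<Rightarrow> (real \<Rightarrow> real) \<Rightarrow> real \<Rightarrow> real" where
  "conv \<mu> u x = (\<integral>y. u (x - y) \<partial>\<mu>)"

definition Linf_norm :: "(real \<Rightarrow> real) \<Rightarrow> ereal" where
  "Linf_norm g = esssup lborel (\<lambda>x. ereal \<bar>g x\<bar>)"

definition is_solution :: "real measure \<Rightarrow> (real \<Rightarrow> real) \<Rightarrow> (real \<Rightarrow> real \<Rightarrow> real) \<Rightarrow> bool" where
  "is_solution \<mu> f u \<longleftrightarrow>
     (\<forall>t. u t \<in> borel_measurable borel \<and> bounded (range (u t))) \<and>
     (\<forall>t. ((\<lambda>h. Linf_norm (\<lambda>x. (u (t + h) x - u t x) / h
                  - (conv \<mu> (u t) x - u t x + f (u t x)))) \<longlongrightarrow> 0) (at 0))"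

end

theory Submission
  imports Defs "HOL-Complex_Analysis.Great_Picard"
begin

text \<open>
  Replace \<open>c \<phi>'\<close> by an upwind difference quotient with mesh \<open>h\<close> and \<open>c = k h\<close>. The discretised profile
  equation is the fixed point equation of an order preserving operator on monotone functions
  \<open>\<real> \<rightarrow> [0, 1]\<close>, so Knaster-Tarski gives extremal solutions on \<open>(0, N)\<close> with values \<open>0\<close> and \<open>1\<close> outside.
  Either some speed makes the solution stay below \<open>\<alpha> + \<epsilon>\<close> far from the left end and above \<open>\<alpha> - \<epsilon>\<close> far from
  the right end, or (by connectedness of the set of speeds) some speed admits both a subsolution vanishing on a left
  half-line and a supersolution equal to \<open>1\<close> on a right half-line, hence an entire front between them.

  Now let \<open>h \<rightarrow> 0\<close> and translate so that the level \<open>(1 + \<alpha>) / 2\<close>, respectively \<open>\<alpha> / 2\<close>, is crossed at the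
  origin. If neither limit is a wave from \<open>0\<close> to \<open>1\<close>, then with one and the same \<open>c\<close> there are a
  supersolution emanating from \<open>\<alpha>\<close> at \<open>-\<infinity>\<close> and a subsolution tending to \<open>\<alpha>\<close> at \<open>+\<infinity>\<close>. Because
  \<open>f'(\<alpha>) > 0\<close>, the first forces \<open>c + b \<ge> 0\<close> and the second \<open>c + b \<le> 0\<close>, where \<open>b\<close> is a truncated mean of
  \<open>\<mu>\<close>; equality in both is possible only if \<open>\<mu>\<close> is the Dirac mass at \<open>0\<close>, for which a step function
  is a stationary wave.

  The reflection \<open>\<phi>(x) \<mapsto> 1 - \<phi>(-x)\<close> exchanges sub- and supersolutions and preserves the hypotheses, so
  one side suffices.
\<close>

section \<open>Profiles, reflection and the nonlocal operator\<close>

definition profile :: "(real \<Rightarrow> real) \<Rightarrow> bool" where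
  "profile \<phi> \<longleftrightarrow> mono \<phi> \<and> (\<forall>x. 0 \<le> \<phi> x \<and> \<phi> x \<le> 1)"

definition rhs :: "real measure \<Rightarrow> (real \<Rightarrow> real) \<Rightarrow> (real \<Rightarrow> real) \<Rightarrow> real \<Rightarrow> real" where
  "rhs \<mu> f \<phi> x = conv \<mu> \<phi> x - \<phi> x + f (\<phi> x)"

text \<open>The upwind discretisation of \<open>c \<phi>'\<close> for \<open>c = k h\<close>.\<close>

definition upwind :: "real \<Rightarrow> real \<Rightarrow> (real \<Rightarrow> real) \<Rightarrow> real \<Rightarrow> real" where
  "upwind k h \<phi> x = max k 0 * (\<phi> x - \<phi> (x - h)) - max (- k) 0 * (\<phi> (x + h) - \<phi> x)"

definition flip :: "(real \<Rightarrow> real) \<Rightarrow> real \<Rightarrow> real" where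
  "flip \<phi> x = 1 - \<phi> (- x)"

lemma profileI: "(\<And>x y. x \<le> y \<Longrightarrow> \<phi> x \<le> \<phi> y) \<Longrightarrow> (\<And>x. 0 \<le> \<phi> x) \<Longrightarrow> (\<And>x. \<phi> x \<le> 1) \<Longrightarrow> profile \<phi>"
  unfolding profile_def mono_def by auto

lemma profileD:
  assumes "profile \<phi>"
  shows "x \<le> y \<Longrightarrow> \<phi> x \<le> \<phi> y" "0 \<le> \<phi> x" "\<phi> x \<le> 1"
  using assms unfolding profile_def mono_def by auto

lemma profile_measurable: "profile \<phi> \<Longrightarrow> \<phi> \<in> borel_measurable borel"
  unfolding profile_def by (auto intro: borel_measurable_mono)

lemma profile_shift: "profile \<phi> \<Longrightarrow> profile (\<lambda>x. \<phi> (x + a))"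
  unfolding profile_def mono_def by auto

lemma profile_flip: "profile \<phi> \<Longrightarrow> profile (flip \<phi>)"
  unfolding profile_def mono_def flip_def by auto

lemma flip_flip [simp]: "flip (flip \<phi>) = \<phi>"
  by (simp add: flip_def fun_eq_iff)

lemma profile_lim:
  assumes "\<And>n. profile (\<phi> n)" "\<And>x. (\<lambda>n. \<phi> n x) \<longlonglongrightarrow> \<psi> x"
  shows "profile \<psi>"
proof (rule profileI)
  fix x y :: real assume "x \<le> y"
  show "\<psi> x \<le> \<psi> y"
    by (rule LIMSEQ_le[OF assms(2) assms(2)]) (use profileD(1)[OF assms(1) \<open>x \<le> y\<close>] in auto)
next
  fix x show "0 \<le> \<psi> x"
    by (rule LIMSEQ_le_const[OF assms(2)]) (use profileD[OF assms(1)] in auto)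
  show "\<psi> x \<le> 1"
    by (rule LIMSEQ_le_const2[OF assms(2)]) (use profileD[OF assms(1)] in auto)
qed

lemma upwind_lim:
  assumes "\<And>x. (\<lambda>n. \<phi> n x) \<longlonglongrightarrow> \<psi> x" "k \<longlonglongrightarrow> k'"
  shows "(\<lambda>n. upwind (k n) h (\<phi> n) x) \<longlonglongrightarrow> upwind k' h \<psi> x"
  unfolding upwind_def by (intro tendsto_intros assms)

lemma upwind_mono_k:
  assumes "profile \<phi>" "0 \<le> h" "k \<le> k'"
  shows "upwind k h \<phi> x \<le> upwind k' h \<phi> x"
  unfolding upwind_def
  by (intro diff_mono mult_right_mono) (use assms profileD(1)[OF assms(1)] in auto)

lemma upwind_flip: "upwind (- k) h (flip \<phi>) x = - upwind k h \<phi> (- x)"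
proof -
  have "- (x - h) = - x + h" "- (x + h) = - x - h" by auto
  then show ?thesis unfolding upwind_def flip_def by (simp only:) (simp add: algebra_simps)
qed

lemma upwind_shift: "upwind k h (\<lambda>x. \<phi> (x + a)) x = upwind k h \<phi> (x + a)"
  unfolding upwind_def by (simp add: algebra_simps)

lemma rhs_shift: "rhs \<mu> f (\<lambda>x. \<phi> (x + a)) x = rhs \<mu> f \<phi> (x + a)"
  unfolding rhs_def conv_def by (simp add: algebra_simps)

text \<open>Helly selection at every point. A diagonal subsequence converges on the rationals and
  its limits define the monotone \<open>g\<close>; monotonicity forces convergence wherever
  \<open>g\<close> is continuous; a second diagonal subsequence handles the countably many remaining
  points. Convergence everywhere permits dominated convergence under a \<open>\<mu>\<close> with
  atoms.\<close>

lemma profile_subsequence: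
  fixes \<phi> :: "nat \<Rightarrow> real \<Rightarrow> real"
  assumes P: "\<And>n. profile (\<phi> n)"
  obtains r \<psi> where "strict_mono (r::nat\<Rightarrow>nat)" "profile \<psi>" "\<And>x. (\<lambda>n. \<phi> (r n) x) \<longlonglongrightarrow> \<psi> x"
proof -
  have bd: "norm (\<phi> n x) \<le> 1" for n x using profileD[OF P[of n]] by auto
  obtain r1 where r1: "strict_mono r1" "\<And>x. x \<in> \<rat> \<Longrightarrow> \<exists>l. (\<lambda>n. \<phi> (r1 n) x) \<longlonglongrightarrow> l"
    using function_convergent_subsequence[of "\<rat>::real set" \<phi> 1] bd countable_rat by blast
  define g where "g x = (INF q\<in>{q\<in>\<rat>. x < q}. lim (\<lambda>n. \<phi> (r1 n) q))" for x
  have l: "(\<lambda>n. \<phi> (r1 n) q) \<longlonglongrightarrow> lim (\<lambda>n. \<phi> (r1 n) q)" if "q \<in> \<rat>" for q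
    using r1(2)[OF that] convergentI convergent_LIMSEQ_iff by blast
  have l0: "0 \<le> lim (\<lambda>n. \<phi> (r1 n) q)" if "q \<in> \<rat>" for q
    by (rule LIMSEQ_le_const[OF l[OF that]]) (use profileD[OF P] in auto)
  have bdd: "bdd_below ((\<lambda>q. lim (\<lambda>n. \<phi> (r1 n) q)) ` {q\<in>\<rat>. x < q})" for x
    using l0 by (intro bdd_belowI[of _ 0]) auto
  have ne: "{q\<in>\<rat>. x < q} \<noteq> {}" for x :: real
    using Rats_no_top_le Rats_dense_in_real[of x "x+1"] by auto
  have "mono g"
    unfolding g_def by (intro monoI cINF_superset_mono ne bdd) auto
  then have cD: "countable {x. \<not> isCont g x}" by (rule mono_ctble_discont)
  obtain r2 where r2: "strict_mono r2"
    "\<And>x. x \<in> {x. \<not> isCont g x} \<Longrightarrow> \<exists>l. (\<lambda>n. \<phi> (r1 (r2 n)) x) \<longlonglongrightarrow> l"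
    using function_convergent_subsequence[OF cD, of "\<lambda>n. \<phi> (r1 n)" 1] bd by blast
  have conv: "(\<lambda>n. \<phi> (r1 n) x) \<longlonglongrightarrow> g x" if C: "isCont g x" for x
  proof (rule LIMSEQ_I)
    fix e :: real assume e: "0 < e"
    obtain d where d: "d > 0" "\<And>y. \<bar>y - x\<bar> < d \<Longrightarrow> \<bar>g y - g x\<bar> < e/2"
      using C[unfolded continuous_at_eps_delta, rule_format, of "e/2"] e by (auto simp: dist_real_def)
    obtain y where y: "y = x - d/2" by simp
    obtain q1 where q1: "q1 \<in> \<rat>" "y < q1" "q1 < x" using Rats_dense_in_real[of y x] d y by auto
    have "g y \<le> lim (\<lambda>n. \<phi> (r1 n) q1)"
      unfolding g_def by (rule cINF_lower[OF bdd]) (use q1 in auto)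
    moreover have "\<bar>g y - g x\<bar> < e/2" using d y by (intro d(2)) auto
    ultimately have lo: "g x - e/2 < lim (\<lambda>n. \<phi> (r1 n) q1)" by linarith
    have "g x < g x + e/2" using e by simp
    then obtain q2 where q2: "q2 \<in> \<rat>" "x < q2" "lim (\<lambda>n. \<phi> (r1 n) q2) < g x + e/2"
      unfolding g_def cINF_less_iff[OF ne bdd] by auto
    have "\<forall>\<^sub>F n in sequentially. g x - e/2 < \<phi> (r1 n) q1" "\<forall>\<^sub>F n in sequentially. \<phi> (r1 n) q2 < g x + e/2"
      using order_tendstoD[OF l[OF q1(1)]] order_tendstoD[OF l[OF q2(1)]] lo q2 by blast+
    then have "\<forall>\<^sub>F n in sequentially. norm (\<phi> (r1 n) x - g x) < e"
    proof eventually_elim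
      case (elim n)
      then show ?case using profileD(1)[OF P[of "r1 n"], of q1 x] profileD(1)[OF P[of "r1 n"], of x q2] q1 q2 e by auto
    qed
    then show "\<exists>no. \<forall>n\<ge>no. norm (\<phi> (r1 n) x - g x) < e" by (simp add: eventually_sequentially)
  qed
  have "\<exists>l. (\<lambda>n. \<phi> (r1 (r2 n)) x) \<longlonglongrightarrow> l" for x
    using r2(2)[of x] LIMSEQ_subseq_LIMSEQ[OF conv[of x] r2(1)] by (cases "isCont g x") (auto simp: o_def)
  then obtain \<psi> where \<psi>: "\<And>x. (\<lambda>n. \<phi> (r1 (r2 n)) x) \<longlonglongrightarrow> \<psi> x" by metis
  show thesis
    using that[of "r1 \<circ> r2" \<psi>] strict_mono_o[OF r1(1) r2(1)] \<psi> profile_lim[OF P \<psi>] by simp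
qed

text \<open>\<open>\<kappa>\<close> and \<open>\<delta>\<close> quantify f'(\<alpha>) > 0: near
  \<open>\<alpha>\<close> the quotient of \<open>f u\<close> by \<open>u - \<alpha>\<close> is at
  least \<open>\<kappa>\<close>. Multiplication by the square treats both sides of
  \<open>\<alpha>\<close> at once and makes the condition invariant under reflection.\<close>

locale bistable =
  fixes \<mu> :: "real measure" and f :: "real \<Rightarrow> real" and \<alpha> L \<kappa> \<delta> :: real
  assumes sets_mu [measurable_cong]: "sets \<mu> = sets borel"
    and prob_mu: "prob_space \<mu>"
    and L0: "0 \<le> L" and lip: "\<And>u v. \<bar>f u - f v\<bar> \<le> L * \<bar>u - v\<bar>"
    and al: "0 < \<alpha>" "\<alpha> < 1"
    and f0 [simp]: "f 0 = 0" and fal [simp]: "f \<alpha> = 0" and f1 [simp]: "f 1 = 0"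
    and fneg: "\<And>u. 0 < u \<Longrightarrow> u < \<alpha> \<Longrightarrow> f u < 0"
    and fpos: "\<And>u. \<alpha> < u \<Longrightarrow> u < 1 \<Longrightarrow> 0 < f u"
    and kd: "0 < \<kappa>" "0 < \<delta>"
    and unstable: "\<And>u. \<bar>u - \<alpha>\<bar> \<le> \<delta> \<Longrightarrow> \<kappa> * (u - \<alpha>)\<^sup>2 \<le> f u * (u - \<alpha>)"
begin

sublocale prob_space \<mu> by (rule prob_mu)

abbreviation "R \<equiv> rhs \<mu> f"

lemma space_mu [simp]: "space \<mu> = UNIV"
  using sets_eq_imp_space_eq[OF sets_mu] by simp

lemma f_cont: "continuous_on UNIV f"
proof -
  have "L-lipschitz_on UNIV f" using lip L0 by (auto simp: lipschitz_on_def dist_real_def)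
  then show ?thesis by (rule lipschitz_on_continuous_on)
qed

lemma f_measurable [measurable]: "f \<in> borel_measurable borel"
  by (rule borel_measurable_continuous_onI[OF f_cont])

lemma f_tendsto: "(g \<longlongrightarrow> l) F \<Longrightarrow> ((\<lambda>x. f (g x)) \<longlongrightarrow> f l) F"
  by (rule continuous_on_tendsto_compose[OF f_cont]) auto

lemma profile_integrable:
  assumes "profile \<phi>" shows "integrable \<mu> (\<lambda>y. \<phi> (x - y))"
proof (rule integrable_const_bound[of _ 1])
  note [measurable] = profile_measurable[OF assms]
  show "(\<lambda>y. \<phi> (x - y)) \<in> borel_measurable \<mu>" by measurable
qed (use profileD[OF assms] in auto)

lemma conv_le: "profile \<phi> \<Longrightarrow> profile \<psi> \<Longrightarrow> (\<And>z. \<phi> (x - z) \<le> \<psi> (y - z)) \<Longrightarrow> conv \<mu> \<phi> x \<le> conv \<mu> \<psi> y"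
  unfolding conv_def by (intro integral_mono profile_integrable) auto

lemma conv_const [simp]: "conv \<mu> (\<lambda>_. l) x = l"
  unfolding conv_def using prob_space by simp

lemma profile_const: "0 \<le> l \<Longrightarrow> l \<le> 1 \<Longrightarrow> profile (\<lambda>_. l)"
  by (auto simp: profile_def mono_def)

lemma conv_profile: assumes "profile \<phi>" shows "profile (conv \<mu> \<phi>)"
proof (rule profileI)
  show "x \<le> y \<Longrightarrow> conv \<mu> \<phi> x \<le> conv \<mu> \<phi> y" for x y
    using profileD[OF assms] by (intro conv_le assms) auto
  show "0 \<le> conv \<mu> \<phi> x" for x
    using conv_le[OF profile_const[of 0] assms, of x x] profileD[OF assms] by simp
  show "conv \<mu> \<phi> x \<le> 1" for x
    using conv_le[OF assms profile_const[of 1], of x x] profileD[OF assms] by simp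
qed

lemma rhs_measurable [measurable]: assumes "profile \<phi>" shows "R \<phi> \<in> borel_measurable borel"
proof -
  note [measurable] = profile_measurable[OF assms] profile_measurable[OF conv_profile[OF assms]]
  show ?thesis unfolding rhs_def[abs_def] by measurable
qed

lemma rhs_bound: assumes "profile \<phi>" shows "\<bar>R \<phi> x\<bar> \<le> 1 + L"
proof -
  have "\<bar>f (\<phi> x)\<bar> \<le> L * \<bar>\<phi> x - 0\<bar>" using lip[of "\<phi> x" 0] by simp
  also have "\<dots> \<le> L * 1" using L0 profileD[OF assms] by (intro mult_left_mono) auto
  finally show ?thesis
    unfolding rhs_def using profileD[OF assms, of x] profileD[OF conv_profile[OF assms], of x] by linarith
qed

lemma rhs_lim:
  assumes "\<And>n. profile (\<phi> n)" "\<And>x. (\<lambda>n. \<phi> n x) \<longlonglongrightarrow> \<psi> x"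
  shows "(\<lambda>n. R (\<phi> n) x) \<longlonglongrightarrow> R \<psi> x"
proof -
  note [measurable] = profile_measurable[OF assms(1)] profile_measurable[OF profile_lim[OF assms]]
  have "(\<lambda>n. conv \<mu> (\<phi> n) x) \<longlonglongrightarrow> conv \<mu> \<psi> x"
    unfolding conv_def
    by (rule integral_dominated_convergence[where w="\<lambda>_. 1"]) (use profileD[OF assms(1)] assms(2) in auto)
  then show ?thesis unfolding rhs_def by (intro tendsto_intros f_tendsto assms(2))
qed

lemma rhs_const [simp]: "R (\<lambda>_. l) x = f l"
  unfolding rhs_def by simp

text \<open>Since reflection stays within the locale, interpreting it at the reflected data yields
  the mirror image of every result, with the two ends of the line and the sign of the speed
  exchanged.\<close>

lemma bistable_flip: "bistable (distr \<mu> borel uminus) (\<lambda>u. - f (1 - u)) (1 - \<alpha>) L \<kappa> \<delta>"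
proof (rule bistable.intro)
  show "prob_space (distr \<mu> borel uminus)" by (rule prob_space_distr) simp
  show "\<bar>- f (1 - u) - - f (1 - v)\<bar> \<le> L * \<bar>u - v\<bar>" for u v
    using lip[of "1 - v" "1 - u"] by simp
  show "\<bar>u - (1 - \<alpha>)\<bar> \<le> \<delta> \<Longrightarrow> \<kappa> * (u - (1 - \<alpha>))\<^sup>2 \<le> - f (1 - u) * (u - (1 - \<alpha>))" for u
    using unstable[of "1 - u"] by (simp add: power2_eq_square algebra_simps abs_minus_commute)
qed (use L0 al kd fneg fpos in auto)

lemma conv_flip: assumes "profile \<phi>" shows "conv (distr \<mu> borel uminus) (flip \<phi>) x = 1 - conv \<mu> \<phi> (- x)"
proof -
  note [measurable] = profile_measurable[OF assms] profile_measurable[OF profile_flip[OF assms]]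
  have "conv (distr \<mu> borel uminus) (flip \<phi>) x = (\<integral>y. flip \<phi> (x + y) \<partial>\<mu>)"
    unfolding conv_def by (subst integral_distr) auto
  also have "\<dots> = (\<integral>y. 1 - \<phi> (- x - y) \<partial>\<mu>)" by (simp add: flip_def)
  also have "\<dots> = 1 - conv \<mu> \<phi> (- x)"
    unfolding conv_def by (subst Bochner_Integration.integral_diff) (use prob_space in \<open>auto simp: profile_integrable[OF assms]\<close>)
  finally show ?thesis .
qed

lemma rhs_flip: "profile \<phi> \<Longrightarrow> rhs (distr \<mu> borel uminus) (\<lambda>u. - f (1 - u)) (flip \<phi>) x = - R \<phi> (- x)"
  unfolding rhs_def by (subst conv_flip) (auto simp: flip_def)

lemma distr_uminus_twice: "distr (distr \<mu> borel uminus) borel uminus = \<mu>"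
proof -
  have "distr (distr \<mu> borel uminus) borel uminus = distr \<mu> borel (\<lambda>x. x)"
    by (subst distr_distr) (auto simp: o_def)
  also have "\<dots> = \<mu>" by (rule distr_id2) (simp add: sets_mu)
  finally show ?thesis .
qed

lemma flip_simps [simp]:
  "distr (distr \<mu> borel uminus) borel uminus = \<mu>"
  "(\<lambda>u. - (- f (1 - (1 - u)))) = f" "1 - (1 - \<alpha>) = \<alpha>"
  by (auto simp: distr_uminus_twice)

end

section \<open>Truncated problems for the upwind scheme\<close>

definition gfix :: "((real \<Rightarrow> real) \<Rightarrow> real \<Rightarrow> real) \<Rightarrow> real \<Rightarrow> real" where
  "gfix F x = (SUP u\<in>{u. profile u \<and> (\<forall>x. u x \<le> F u x)}. u x)"

text \<open>Knaster-Tarski in the lattice of profiles with pointwise suprema; the zero profile keeps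
  the set of competitors nonempty.\<close>

lemma gfix:
  assumes maps: "\<And>u. profile u \<Longrightarrow> profile (F u)"
    and mono: "\<And>u v x. profile u \<Longrightarrow> profile v \<Longrightarrow> (\<And>x. u x \<le> v x) \<Longrightarrow> F u x \<le> F v x"
  shows profile_gfix: "profile (gfix F)"
    and gfix_upper: "\<And>u x. profile u \<Longrightarrow> (\<And>x. u x \<le> F u x) \<Longrightarrow> u x \<le> gfix F x"
    and gfix_fixpoint: "F (gfix F) = gfix F"
proof -
  let ?S = "{u. profile u \<and> (\<forall>x. u x \<le> F u x)}"
  have zero: "(\<lambda>_. 0) \<in> ?S"
    using profileD(2)[OF maps] by (auto simp: profile_def mono_def)
  have bdd: "bdd_above ((\<lambda>u. u x) ` ?S)" for x
    by (rule bdd_aboveI[of _ 1]) (auto simp: profileD)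
  show upper: "u x \<le> gfix F x" if "profile u" "\<And>x. u x \<le> F u x" for u x
    unfolding gfix_def by (rule cSUP_upper[OF _ bdd]) (use that in auto)
  show prof: "profile (gfix F)"
  proof (rule profileI)
    show "x \<le> y \<Longrightarrow> gfix F x \<le> gfix F y" for x y
      unfolding gfix_def using zero
      by (intro cSUP_mono bdd) (auto intro: profileD(1))
    show "0 \<le> gfix F x" for x
      using upper[of "\<lambda>_. 0"] zero by auto
    show "gfix F x \<le> 1" for x
      unfolding gfix_def by (rule cSUP_least) (use zero profileD in auto)
  qed
  have le: "gfix F x \<le> F (gfix F) x" for x
  proof -
    have "u x \<le> F (gfix F) x" if "u \<in> ?S" for u
    proof -
      have "F u x \<le> F (gfix F) x" by (rule mono[OF _ prof upper]) (use that in auto)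
      moreover have "u x \<le> F u x" using that by simp
      ultimately show ?thesis by simp
    qed
    then show ?thesis using zero unfolding gfix_def[of F x] by (intro cSUP_least) auto
  qed
  have "F (gfix F) x \<le> gfix F x" for x
    by (rule upper) (use maps prof mono le in auto)
  with le show "F (gfix F) = gfix F" by (auto simp: fun_eq_iff intro: antisym)
qed

section \<open>An order preserving form of the upwind equation\<close>

context bistable begin

text \<open>The upwind equation solved for its diagonal part: all multiples of
  \<open>\<phi> x\<close> are collected, and \<open>L * \<phi> x\<close> is added on both sides so
  that \<open>L * u + f u\<close> is nondecreasing in \<open>u\<close>. Upwinding gives the
  neighbours nonnegative weights, so the operator preserves order, and its fixed points are exactly
  the solutions.\<close>

definition step :: "real \<Rightarrow> real \<Rightarrow> (real \<Rightarrow> real) \<Rightarrow> real \<Rightarrow> real" where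
  "step k h \<phi> x = (max k 0 * \<phi> (x - h) + max (- k) 0 * \<phi> (x + h) + conv \<mu> \<phi> x
     + (L * \<phi> x + f (\<phi> x))) / (1 + L + \<bar>k\<bar>)"

lemma step_denominator_pos: "0 < 1 + L + \<bar>k\<bar>" using L0 by linarith

lemma step_diff: "step k h \<phi> x - \<phi> x = (R \<phi> x - upwind k h \<phi> x) / (1 + L + \<bar>k\<bar>)"
proof -
  have "\<bar>k\<bar> = max k 0 + max (- k) 0" by auto
  then have "(1 + L + \<bar>k\<bar>) * (step k h \<phi> x - \<phi> x) = R \<phi> x - upwind k h \<phi> x"
    using step_denominator_pos[of k] by (simp add: step_def rhs_def upwind_def field_simps)
  then show ?thesis using step_denominator_pos[of k] by (simp add: field_simps)
qed

lemma step_ge_iff: "\<phi> x \<le> step k h \<phi> x \<longleftrightarrow> upwind k h \<phi> x \<le> R \<phi> x"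
proof -
  have "\<phi> x \<le> step k h \<phi> x \<longleftrightarrow> 0 \<le> step k h \<phi> x - \<phi> x" by simp
  then show ?thesis unfolding step_diff using step_denominator_pos[of k] by (simp add: zero_le_divide_iff)
qed

lemma step_le_iff: "step k h \<phi> x \<le> \<phi> x \<longleftrightarrow> R \<phi> x \<le> upwind k h \<phi> x"
proof -
  have "step k h \<phi> x \<le> \<phi> x \<longleftrightarrow> step k h \<phi> x - \<phi> x \<le> 0" by simp
  then show ?thesis unfolding step_diff using step_denominator_pos[of k] by (simp add: divide_le_0_iff)
qed

lemma step_mono:
  assumes "profile \<phi>" "profile \<psi>" "\<And>x. \<phi> x \<le> \<psi> x"
  shows "step k h \<phi> x \<le> step k h \<psi> x"
proof -
  have "f (\<phi> x) - f (\<psi> x) \<le> L * (\<psi> x - \<phi> x)"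
    using lip[of "\<phi> x" "\<psi> x"] assms(3)[of x] by (simp add: abs_le_iff)
  then have e: "L * \<phi> x + f (\<phi> x) \<le> L * \<psi> x + f (\<psi> x)" by (simp add: algebra_simps)
  then show ?thesis
    unfolding step_def using step_denominator_pos[of k]
    by (intro divide_right_mono add_mono[OF add_mono[OF add_mono] e] mult_left_mono conv_le) (use assms in auto)
qed

lemma step_shift: "step k h (\<lambda>x. \<phi> (x + a)) x = step k h \<phi> (x + a)"
  unfolding step_def conv_def by (simp add: algebra_simps)

text \<open>Monotonicity in \<open>x\<close> comes from comparing \<open>\<phi>\<close> with its own
  translate, because \<open>step\<close> commutes with translations and preserves order.\<close>

lemma step_profile: assumes "profile \<phi>" shows "profile (step k h \<phi>)"
proof (rule profileI)
  fix x y :: real assume "x \<le> y"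
  have "step k h \<phi> x \<le> step k h (\<lambda>z. \<phi> (z + (y - x))) x"
    using \<open>x \<le> y\<close> by (intro step_mono profile_shift assms profileD(1)[OF assms]) auto
  then show "step k h \<phi> x \<le> step k h \<phi> y" using step_shift[of k h \<phi> "y - x" x] by simp
next
  fix x
  have "step k h (\<lambda>_. 0) x \<le> step k h \<phi> x"
    by (intro step_mono assms profile_const) (use profileD[OF assms] in auto)
  then show "0 \<le> step k h \<phi> x" by (simp add: step_def)
  have "step k h \<phi> x \<le> step k h (\<lambda>_. 1) x"
    by (intro step_mono assms profile_const) (use profileD[OF assms] in auto)
  also have "step k h (\<lambda>_. 1) x = 1" using step_diff[of k h "\<lambda>_. 1" x] by (simp add: upwind_def)
  finally show "step k h \<phi> x \<le> 1" .
qed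

section \<open>Greatest solutions on (0, N) and their dependence on the speed\<close>

definition trunc :: "real \<Rightarrow> real \<Rightarrow> real \<Rightarrow> (real \<Rightarrow> real) \<Rightarrow> real \<Rightarrow> real" where
  "trunc h N k \<phi> x = (if x \<le> 0 then 0 else if N \<le> x then 1 else step k h \<phi> x)"

text \<open>Choosing the greatest solution replaces uniqueness: every subsolution that vanishes on
  the left half-line lies below it, and the dependence on \<open>k\<close> and \<open>N\<close>
  follows from this alone.\<close>

definition gmax :: "real \<Rightarrow> real \<Rightarrow> real \<Rightarrow> real \<Rightarrow> real" where
  "gmax h k N = gfix (trunc h N k)"

lemma trunc_profile: "profile \<phi> \<Longrightarrow> profile (trunc h N k \<phi>)"
  by (rule profileI) (auto simp: trunc_def profileD[OF step_profile])

lemma trunc_mono: "profile u \<Longrightarrow> profile v \<Longrightarrow> (\<And>x. u x \<le> v x) \<Longrightarrow> trunc h N k u x \<le> trunc h N k v x"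
  by (auto simp: trunc_def intro: step_mono)

lemma gmax_profile: "profile (gmax h k N)"
  unfolding gmax_def by (rule profile_gfix[OF trunc_profile trunc_mono])

lemma gmax_eq: "trunc h N k (gmax h k N) = gmax h k N"
  unfolding gmax_def by (rule gfix_fixpoint[OF trunc_profile trunc_mono])

lemma gmax_left: "x \<le> 0 \<Longrightarrow> gmax h k N x = 0"
  by (subst gmax_eq[symmetric]) (simp add: trunc_def)

lemma gmax_right: "0 < N \<Longrightarrow> N \<le> x \<Longrightarrow> gmax h k N x = 1"
  by (subst gmax_eq[symmetric]) (simp add: trunc_def)

lemma gmax_inside: assumes "0 < x" "x < N" shows "upwind k h (gmax h k N) x = R (gmax h k N) x"
proof -
  have "step k h (gmax h k N) x = gmax h k N x"
    using fun_cong[OF gmax_eq[of h N k], of x] assms by (simp add: trunc_def)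
  then show ?thesis
    using step_ge_iff[of "gmax h k N" x k h] step_le_iff[of k h "gmax h k N" x] by auto
qed

lemma gmax_greatest:
  assumes "profile u" "\<And>x. x \<le> 0 \<Longrightarrow> u x = 0" "\<And>x. 0 < x \<Longrightarrow> x < N \<Longrightarrow> upwind k h u x \<le> R u x"
  shows "u x \<le> gmax h k N x"
  unfolding gmax_def
proof (rule gfix_upper[OF trunc_profile trunc_mono])
  show "u x \<le> trunc h N k u x" for x
    using assms(2,3)[of x] profileD(3)[OF assms(1)] step_ge_iff[of u x k h] by (auto simp: trunc_def)
qed (use assms in auto)

text \<open>A larger speed raises the upwind term of a monotone function, so the solution for the
  larger \<open>k\<close> and \<open>N\<close> is a subsolution of the other problem.\<close>

lemma gmax_antimono:
  assumes "k \<le> k'" "N \<le> N'" "0 \<le> h"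
  shows "gmax h k' N' x \<le> gmax h k N x"
proof (rule gmax_greatest)
  show "upwind k h (gmax h k' N') x \<le> R (gmax h k' N') x" if "0 < x" "x < N" for x
    using upwind_mono_k[OF gmax_profile[of h k' N'] assms(3,1), of x] gmax_inside[of x N' k' h] that assms by simp
qed (auto simp: gmax_profile gmax_left)

text \<open>As the speed increases to \<open>k\<close> the solutions decrease. Their limit is a
  subsolution for \<open>k\<close>, hence below the greatest solution, while antitonicity keeps it
  above.\<close>

lemma gmax_left_continuous:
  assumes "0 \<le> h"
  shows "(\<lambda>n. gmax h (k - 1 / real (Suc n)) N x) \<longlonglongrightarrow> gmax h k N x"
proof -
  let ?u = "\<lambda>n. gmax h (k - 1 / real (Suc n)) N"
  have "decseq (\<lambda>n. ?u n x)" for x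
    by (intro decseq_SucI gmax_antimono assms) (auto simp: field_simps)
  then have "\<exists>l. (\<lambda>n. ?u n x) \<longlonglongrightarrow> l" for x
    using decseq_convergent[of "\<lambda>n. ?u n x" 0] profileD(2)[OF gmax_profile] by metis
  then obtain \<psi> where \<psi>: "\<And>x. (\<lambda>n. ?u n x) \<longlonglongrightarrow> \<psi> x" by metis
  have P: "profile \<psi>" by (rule profile_lim[OF gmax_profile \<psi>])
  have k: "(\<lambda>n. k - 1 / real (Suc n)) \<longlonglongrightarrow> k"
    using tendsto_diff[OF tendsto_const[of k] LIMSEQ_inverse_real_of_nat] by (simp add: inverse_eq_divide)
  have "\<psi> x \<le> gmax h k N x"
  proof (rule gmax_greatest[OF P])
    show "\<psi> x = 0" if "x \<le> 0" for x
      using \<psi>[of x] gmax_left[OF that] by (simp add: LIMSEQ_const_iff)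
    fix x assume x: "0 < x" "x < N"
    have "(\<lambda>n. upwind (k - 1 / real (Suc n)) h (?u n) x) \<longlonglongrightarrow> upwind k h \<psi> x"
      by (rule upwind_lim[OF \<psi> k])
    moreover have "(\<lambda>n. R (?u n) x) \<longlonglongrightarrow> R \<psi> x" by (rule rhs_lim[OF gmax_profile \<psi>])
    ultimately show "upwind k h \<psi> x \<le> R \<psi> x"
      unfolding gmax_inside[OF x] by (metis LIMSEQ_unique order.refl)
  qed
  moreover have "gmax h k N x \<le> \<psi> x"
    by (rule LIMSEQ_le_const[OF \<psi>]) (auto intro!: gmax_antimono assms)
  ultimately show ?thesis using \<psi>[of x] by simp
qed

text \<open>Because \<open>gmax\<close> decreases in \<open>N\<close>, one good \<open>N\<close>
  makes all longer intervals good. For a speed outside this set the solution at \<open>r\<close>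
  stays at or above \<open>\<alpha> + \<epsilon>\<close> however far the right end recedes.\<close>

definition left_low :: "real \<Rightarrow> real \<Rightarrow> real \<Rightarrow> real set" where
  "left_low h r \<epsilon> = {k. \<exists>N>r. gmax h k N r < \<alpha> + \<epsilon>}"

lemma left_low_upward: "0 \<le> h \<Longrightarrow> k \<in> left_low h r \<epsilon> \<Longrightarrow> k \<le> k' \<Longrightarrow> k' \<in> left_low h r \<epsilon>"
  unfolding left_low_def by (auto intro: le_less_trans[OF gmax_antimono])

text \<open>Left continuity puts a slightly smaller speed into the set, and upward closure then
  supplies a whole neighbourhood.\<close>

lemma left_low_open: assumes "0 \<le> h" shows "open (left_low h r \<epsilon>)"
  unfolding open_dist
proof
  fix k assume "k \<in> left_low h r \<epsilon>"
  then obtain N where N: "r < N" "gmax h k N r < \<alpha> + \<epsilon>" by (auto simp: left_low_def)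
  have "\<forall>\<^sub>F n in sequentially. gmax h (k - 1 / real (Suc n)) N r < \<alpha> + \<epsilon>"
    using order_tendstoD(2)[OF gmax_left_continuous[OF assms] N(2)] .
  then obtain n where "gmax h (k - 1 / real (Suc n)) N r < \<alpha> + \<epsilon>"
    by (auto simp: eventually_sequentially)
  then have "k - 1 / real (Suc n) \<in> left_low h r \<epsilon>" using N by (auto simp: left_low_def)
  then have "\<forall>y. dist y k < 1 / real (Suc n) \<longrightarrow> y \<in> left_low h r \<epsilon>"
    by (auto simp: dist_real_def intro: left_low_upward[OF assms])
  then show "\<exists>e>0. \<forall>y. dist y k < e \<longrightarrow> y \<in> left_low h r \<epsilon>"
    by (intro exI[of _ "1 / real (Suc n)"]) auto
qed

text \<open>At a large speed the equation limits each increment over a distance \<open>h\<close> to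
  \<open>(1 + L) / k\<close>. At most \<open>j\<close> such increments lead from the value 0 to the
  point \<open>r\<close>, and \<open>k\<close> is chosen to make their sum exactly
  \<open>\<epsilon>\<close>.\<close>

lemma left_low_nonempty:
  assumes h: "0 < h" and r: "0 \<le> r" and e: "0 < \<epsilon>" shows "left_low h r \<epsilon> \<noteq> {}"
proof -
  obtain j :: nat where j: "r < real j * h" using reals_Archimedean3[OF h] by blast
  have j0: "0 < real j" using j r h by (cases j) auto
  define k where "k = real j * (1 + L) / \<epsilon>"
  have k0: "0 < k" unfolding k_def using j0 e L0 by auto
  let ?u = "gmax h k (r + 1)"
  have it: "x < r + 1 \<Longrightarrow> x \<le> real i * h \<Longrightarrow> ?u x \<le> real i * (1 + L) / k" for x i
  proof (induction i arbitrary: x)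
    case 0
    then show ?case by (simp add: gmax_left)
  next
    case (Suc i)
    show ?case
    proof (cases "x \<le> 0")
      case True
      then show ?thesis using k0 L0 by (simp add: gmax_left)
    next
      case False
      have "upwind k h ?u x = R ?u x" by (rule gmax_inside) (use False Suc in auto)
      then have "k * (?u x - ?u (x - h)) \<le> 1 + L"
        using rhs_bound[OF gmax_profile, of h k "r+1" x] k0 by (simp add: upwind_def)
      then have "?u x \<le> ?u (x - h) + (1 + L) / k" using k0 by (simp add: field_simps)
      moreover have "?u (x - h) \<le> real i * (1 + L) / k"
        by (rule Suc.IH) (use Suc.prems h in \<open>auto simp: algebra_simps\<close>)
      ultimately show ?thesis by (simp add: add_divide_distrib distrib_right)
    qed
  qed
  have "?u r \<le> real j * (1 + L) / k" by (rule it) (use j in auto)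
  also have "\<dots> = \<epsilon>"
  proof -
    have "X / (X / \<epsilon>) = \<epsilon>" if "0 < X" for X using that e by simp
    from this[of "real j * (1 + L)"] show ?thesis unfolding k_def using j0 L0 by simp
  qed
  finally have "?u r < \<alpha> + \<epsilon>" using al by simp
  then have "k \<in> left_low h r \<epsilon>" unfolding left_low_def by (auto intro!: exI[of _ "r + 1"])
  then show ?thesis by blast
qed

text \<open>The right end is sent to infinity. The decreasing limit inherits the equation on the
  right half-line; where it vanishes, the upwind term is at most 0 and \<open>R\<close> at least 0,
  so it is a subsolution on the whole line.\<close>

lemma subsolution_if_not_left_low:
  assumes h: "0 \<le> h" and r: "0 \<le> r" and k: "k \<notin> left_low h r \<epsilon>"
  obtains u where "profile u" "\<And>x. x \<le> 0 \<Longrightarrow> u x = 0" "\<And>x. upwind k h u x \<le> R u x" "\<alpha> + \<epsilon> \<le> u r"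
proof -
  let ?u = "\<lambda>n. gmax h k (r + real (Suc n))"
  have "decseq (\<lambda>n. ?u n x)" for x by (intro decseq_SucI gmax_antimono h) auto
  then have "\<exists>l. (\<lambda>n. ?u n x) \<longlonglongrightarrow> l" for x
    using decseq_convergent[of "\<lambda>n. ?u n x" 0] profileD(2)[OF gmax_profile] by metis
  then obtain \<psi> where \<psi>: "\<And>x. (\<lambda>n. ?u n x) \<longlonglongrightarrow> \<psi> x" by metis
  have P: "profile \<psi>" by (rule profile_lim[OF gmax_profile \<psi>])
  have z: "\<psi> x = 0" if "x \<le> 0" for x
    using \<psi>[of x] gmax_left[OF that] by (simp add: LIMSEQ_const_iff)
  have "upwind k h \<psi> x \<le> R \<psi> x" for x
  proof (cases "x \<le> 0")
    case True
    then have "\<psi> (x - h) = 0" using z h by auto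
    then have "upwind k h \<psi> x \<le> 0" using z[OF True] profileD(2)[OF P] by (simp add: upwind_def)
    also have "0 \<le> R \<psi> x" using z[OF True] profileD(2)[OF conv_profile[OF P]] by (simp add: rhs_def)
    finally show ?thesis .
  next
    case False
    have "(\<lambda>n. upwind k h (?u n) x) \<longlonglongrightarrow> upwind k h \<psi> x" by (rule upwind_lim[OF \<psi> tendsto_const])
    moreover have "(\<lambda>n. R (?u n) x) \<longlonglongrightarrow> R \<psi> x" by (rule rhs_lim[OF gmax_profile \<psi>])
    moreover have "\<forall>\<^sub>F n in sequentially. upwind k h (?u n) x \<le> R (?u n) x"
    proof -
      obtain m :: nat where m: "x < real m" using reals_Archimedean2 by blast
      show ?thesis
        using eventually_ge_at_top[of m]
        by eventually_elim (rule eq_refl, rule gmax_inside, use m False r in auto)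
    qed
    ultimately show ?thesis by (intro tendsto_le[of sequentially "\<lambda>n. R (?u n) x" _ "\<lambda>n. upwind k h (?u n) x"]) auto
  qed
  moreover have "\<alpha> + \<epsilon> \<le> \<psi> r"
  proof (rule LIMSEQ_le_const[OF \<psi>], intro exI allI impI)
    show "\<alpha> + \<epsilon> \<le> ?u n r" for n
      using k[unfolded left_low_def mem_Collect_eq not_ex, THEN spec, of "r + real (Suc n)"] by simp
  qed
  ultimately show thesis using that P z by blast
qed

text \<open>The greatest fixed point of \<open>step\<close> capped by \<open>w\<close>. The cap is
  inactive: below a supersolution, order preservation keeps \<open>step\<close> below
  \<open>w\<close> as well.\<close>

lemma solution_between:
  assumes P: "profile u" "profile w" and le: "\<And>x. u x \<le> w x"
    and sub: "\<And>x. upwind k h u x \<le> R u x" and super: "\<And>x. R w x \<le> upwind k h w x"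
  obtains \<phi> where "profile \<phi>" "\<And>x. upwind k h \<phi> x = R \<phi> x" "\<And>x. u x \<le> \<phi> x" "\<And>x. \<phi> x \<le> w x"
proof -
  define F where "F v x = min (w x) (step k h v x)" for v x
  have maps: "profile (F v)" if "profile v" for v
    by (rule profileI) (auto simp: F_def min_le_iff_disj profileD[OF P(2)] profileD[OF step_profile[OF that]]
      intro: min.coboundedI1 min.coboundedI2)
  have mono: "F v x \<le> F v' x" if "profile v" "profile v'" "\<And>x. v x \<le> v' x" for v v' x
    unfolding F_def using step_mono[OF that] by (intro min.mono) auto
  let ?\<phi> = "gfix F"
  have prof: "profile ?\<phi>" by (rule profile_gfix[of F, OF maps mono])
  have eq: "?\<phi> x = min (w x) (step k h ?\<phi> x)" for x
    using fun_cong[OF gfix_fixpoint[of F, OF maps mono], of x] F_def[of ?\<phi> x] by presburger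
  have lw: "?\<phi> x \<le> w x" for x by (subst eq) simp
  have "step k h ?\<phi> x \<le> w x" for x
    using step_mono[OF prof P(2) lw, of k h x] super[of x] step_le_iff[of k h w x] by linarith
  then have "?\<phi> x = step k h ?\<phi> x" for x using eq[of x] min_absorb2 by metis
  then have "upwind k h ?\<phi> x = R ?\<phi> x" for x
    using step_diff[of k h ?\<phi> x] step_denominator_pos[of k] by (metis diff_self divide_eq_0_iff less_irrefl right_minus_eq)
  moreover have "u x \<le> ?\<phi> x" for x
    by (rule gfix_upper[of F, OF maps mono]) (use P le sub[folded step_ge_iff] in \<open>auto simp: F_def\<close>)
  ultimately show thesis using that prof lw by blast
qed

end

section \<open>Fronts of the upwind scheme\<close>

lemma profile_at_bot:
  assumes "profile \<phi>"
  obtains l where "(\<phi> \<longlongrightarrow> l) at_bot" "\<And>x. l \<le> \<phi> x" "0 \<le> l"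
proof
  let ?l = "INF x. \<phi> x"
  have bdd: "bdd_below (range \<phi>)" using profileD[OF assms] by (intro bdd_belowI[of _ 0]) auto
  show l: "?l \<le> \<phi> x" for x by (rule cINF_lower[OF bdd]) auto
  show "0 \<le> ?l" by (rule cINF_greatest) (use profileD[OF assms] in auto)
  show "(\<phi> \<longlongrightarrow> ?l) at_bot"
  proof (rule order_tendstoI)
    show "\<forall>\<^sub>F x in at_bot. a < \<phi> x" if "a < ?l" for a
      using that l by (intro always_eventually allI) (rule less_le_trans)
    fix a assume "?l < a"
    then obtain y where "\<phi> y < a" using cINF_less_iff[OF _ bdd] by auto
    then show "\<forall>\<^sub>F x in at_bot. \<phi> x < a"
      by (auto simp: eventually_at_bot_linorder intro!: exI[of _ y] intro: le_less_trans[OF profileD(1)[OF assms]])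
  qed
qed

lemma flip_at_top: "(flip \<phi> \<longlongrightarrow> l) at_bot \<Longrightarrow> (\<phi> \<longlongrightarrow> 1 - l) at_top"
proof -
  assume "(flip \<phi> \<longlongrightarrow> l) at_bot"
  then have "((\<lambda>x. flip \<phi> (- x)) \<longlongrightarrow> l) at_top"
    by (rule filterlim_compose[OF _ filterlim_uminus_at_bot_at_top])
  then have "((\<lambda>x. 1 - flip \<phi> (- x)) \<longlongrightarrow> 1 - l) at_top" by (intro tendsto_intros)
  then show ?thesis by (simp add: flip_def)
qed

lemma shift_to_bot:
  assumes "(\<phi> \<longlongrightarrow> (l::real)) at_bot"
  shows "(\<lambda>n. \<phi> (x + - real n)) \<longlonglongrightarrow> l"
proof (rule filterlim_compose[OF assms])
  show "filterlim (\<lambda>n. x + - real n) at_bot sequentially"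
    unfolding filterlim_at_bot
  proof
    fix Z
    obtain m :: nat where m: "x - Z \<le> real m" using real_arch_simple by blast
    show "\<forall>\<^sub>F n in sequentially. x + - real n \<le> Z"
      using eventually_ge_at_top[of m] by eventually_elim (use m in auto)
  qed
qed

context bistable begin

abbreviation "\<mu>' \<equiv> distr \<mu> borel uminus"
abbreviation "f' \<equiv> \<lambda>u. - f (1 - u)"

lemma rhs_of_flip:
  assumes "profile \<psi>" shows "R (flip \<psi>) x = - rhs \<mu>' f' \<psi> (- x)"
  using rhs_flip[OF profile_flip[OF assms], of "- x"] by simp

text \<open>A common description of truncated solutions and entire fronts. For small
  \<open>\<epsilon>\<close> the bounds at \<open>a + r\<close> and \<open>b - r\<close> keep the
  crossing of (1 + \<alpha>) / 2 at least \<open>r\<close> away from \<open>a\<close>, and that of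
  \<alpha> / 2 at least \<open>r\<close> away from \<open>b\<close>. Each inequality extends past
  the opposite end, so it survives a limit in which only one end recedes.\<close>

definition approx_front :: "real \<Rightarrow> real \<Rightarrow> real \<Rightarrow> real \<Rightarrow> real \<Rightarrow> real \<Rightarrow> (real \<Rightarrow> real) \<Rightarrow> bool" where
  "approx_front h r \<epsilon> k a b \<phi> \<longleftrightarrow> profile \<phi> \<and> (\<forall>x>a. R \<phi> x \<le> upwind k h \<phi> x) \<and> (\<forall>x<b. upwind k h \<phi> x \<le> R \<phi> x)
     \<and> \<phi> (a + r) \<le> \<alpha> + \<epsilon> \<and> \<alpha> - \<epsilon> \<le> \<phi> (b - r) \<and> \<phi> a \<le> \<alpha> / 2 \<and> (1 + \<alpha>) / 2 \<le> \<phi> b"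

lemma upwind_of_flip: "upwind k h (flip \<psi>) x = - upwind (- k) h \<psi> (- x)"
  using upwind_flip[of "- k" h \<psi> x] by simp

lemma rhs_at_bot_limit:
  assumes "profile \<phi>" "(\<phi> \<longlongrightarrow> l) at_bot"
  shows "(\<lambda>n. R \<phi> (x + - real n)) \<longlonglongrightarrow> f l"
  using rhs_lim[OF profile_shift[OF assms(1)] shift_to_bot[OF assms(2)], of x] by (simp only: rhs_shift rhs_const)

text \<open>Translates converge to the constant \<open>l\<close>, whose upwind term is 0; hence
  \<open>f l = 0\<close>, and 0 is the only zero of \<open>f\<close> in [0, \<alpha>).\<close>

lemma entire_at_bot:
  assumes P: "profile \<phi>" and eq: "\<And>x. upwind k h \<phi> x = R \<phi> x" and lt: "\<phi> y < \<alpha>"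
  shows "(\<phi> \<longlongrightarrow> 0) at_bot"
proof -
  obtain l where l: "(\<phi> \<longlongrightarrow> l) at_bot" "\<And>x. l \<le> \<phi> x" "0 \<le> l" using profile_at_bot[OF P] by blast
  have "(\<lambda>n. upwind k h (\<lambda>x. \<phi> (x + - real n)) 0) \<longlonglongrightarrow> upwind k h (\<lambda>_. l) 0"
    by (rule upwind_lim[OF shift_to_bot[OF l(1)] tendsto_const])
  then have "(\<lambda>n. R \<phi> (0 + - real n)) \<longlonglongrightarrow> 0" by (subst (asm) upwind_shift) (simp add: eq, simp add: upwind_def)
  then have "f l = 0" using rhs_at_bot_limit[OF P l(1), of 0] LIMSEQ_unique by blast
  moreover have "l < \<alpha>" using l(2)[of y] lt by simp
  ultimately have "l = 0" using fneg[of l] l(3) by force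
  then show ?thesis using l by simp
qed

lemma approx_front_flip:
  assumes "approx_front h r \<epsilon> k a b \<phi>"
  shows "bistable.approx_front \<mu>' f' (1 - \<alpha>) h r \<epsilon> (- k) (- b) (- a) (flip \<phi>)"
proof -
  interpret F: bistable \<mu>' f' "1 - \<alpha>" L \<kappa> \<delta> by (rule bistable_flip)
  have P: "profile \<phi>" using assms by (simp add: approx_front_def)
  show ?thesis
    unfolding F.approx_front_def rhs_flip[OF P] upwind_flip
    using assms profile_flip[OF P] by (auto simp: approx_front_def flip_def field_simps)
qed

text \<open>If a speed serves both ends, the truncated solution itself qualifies. Otherwise some
  speed serves neither, and the resulting sub- and supersolution enclose an entire front.\<close>

lemma approx_front_exists:
  assumes h: "0 < h" and r: "0 < r" and e: "0 < \<epsilon>"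
  shows "\<exists>k a b \<phi>. approx_front h r \<epsilon> k a b \<phi>"
proof -
  interpret F: bistable \<mu>' f' "1 - \<alpha>" L \<kappa> \<delta> by (rule bistable_flip)
  define A where "A = left_low h r \<epsilon>"
  \<comment> \<open>Reflection reverses the speed: \<open>A\<close> is closed upward and
    \<open>B\<close> downward.\<close>
  define B where "B = uminus ` F.left_low h r \<epsilon>"
  have op: "open A" "open B" and ne: "A \<noteq> {}" "B \<noteq> {}"
    unfolding A_def B_def using h r e left_low_open F.left_low_open left_low_nonempty F.left_low_nonempty
    by (auto intro!: open_negations)
  show ?thesis
  proof (cases "A \<inter> B = {}")
    case False
    then obtain k where "k \<in> A" "k \<in> B" by blast
    then have "k \<in> left_low h r \<epsilon>" "- k \<in> F.left_low h r \<epsilon>" by (auto simp: A_def B_def)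
    then obtain N1 N2 where N: "r < N1" "gmax h k N1 r < \<alpha> + \<epsilon>" "r < N2" "F.gmax h (- k) N2 r < 1 - \<alpha> + \<epsilon>"
      by (auto simp: left_low_def F.left_low_def)
    define N where "N = max N1 N2"
    let ?\<phi> = "gmax h k N" and ?\<psi> = "F.gmax h (- k) N"
    have N0: "0 < N" using N r by (auto simp: N_def)
    have phi: "?\<phi> r < \<alpha> + \<epsilon>"
      using gmax_antimono[of k k N1 N h r] N h by (auto simp: N_def)
    have psi: "?\<psi> r < 1 - \<alpha> + \<epsilon>"
      using F.gmax_antimono[of "- k" "- k" N2 N h r] N h by (auto simp: N_def)
    \<comment> \<open>The greatest solution of the mirrored problem, reflected and moved back to (0,
      N). It solves the same truncated problem, so it lies below \<open>?\<phi>\<close> and passes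
      on its lower bound at \<open>N - r\<close>.\<close>
    define w where "w x = flip ?\<psi> (x + - N)" for x
    have "w (N - r) \<le> ?\<phi> (N - r)"
    proof (rule gmax_greatest)
      show "profile w" unfolding w_def by (intro profile_shift profile_flip F.gmax_profile)
      show "w x = 0" if "x \<le> 0" for x
        using that N0 unfolding w_def flip_def by (simp add: F.gmax_right)
      show "upwind k h w x \<le> R w x" if "0 < x" "x < N" for x
        unfolding w_def upwind_shift rhs_shift upwind_of_flip rhs_of_flip[OF F.gmax_profile]
        using that by (subst F.gmax_inside) auto
    qed
    then have "\<alpha> - \<epsilon> \<le> ?\<phi> (N - r)" using psi by (simp add: w_def flip_def)
    moreover have "upwind k h ?\<phi> x \<le> R ?\<phi> x" if "x < N" for x
    proof (cases "x \<le> 0")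
      case True
      then have "x - h \<le> 0" using h by simp
      then show ?thesis
        using True profileD(2)[OF gmax_profile, of h k N "x + h"] profileD(2)[OF conv_profile[OF gmax_profile], of h k N x]
        by (simp add: upwind_def rhs_def gmax_left) (smt (verit) mult_nonneg_nonneg)
    qed (use that gmax_inside in auto)
    moreover have "R ?\<phi> x \<le> upwind k h ?\<phi> x" if "x > 0" for x
    proof (cases "N \<le> x")
      case True
      then have "N \<le> x + h" using h by simp
      then show ?thesis
        using True N0 profileD(3)[OF gmax_profile, of h k N "x - h"] profileD(3)[OF conv_profile[OF gmax_profile], of h k N x]
        by (simp add: upwind_def rhs_def gmax_right) (smt (verit) mult_nonneg_nonneg)
    qed (use that gmax_inside in auto)
    ultimately have "approx_front h r \<epsilon> k 0 N ?\<phi>"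
      unfolding approx_front_def using phi al N0 by (auto simp: gmax_profile gmax_left gmax_right)
    then show ?thesis by blast
  next
    case True
    \<comment> \<open>Two disjoint nonempty open sets cannot cover the connected line.\<close>
    have "A \<union> B \<noteq> UNIV"
      using connectedD[OF connected_UNIV op] True ne by auto
    then obtain k where "k \<notin> left_low h r \<epsilon>" "- k \<notin> F.left_low h r \<epsilon>"
      unfolding A_def B_def by (auto simp: image_iff) (metis minus_minus)
    obtain u where u: "profile u" "\<And>x. x \<le> 0 \<Longrightarrow> u x = 0" "\<And>x. upwind k h u x \<le> R u x" "\<alpha> + \<epsilon> \<le> u r"
      using subsolution_if_not_left_low[OF _ _ \<open>k \<notin> left_low h r \<epsilon>\<close>] h r by auto
    obtain v where v: "profile v" "\<And>x. x \<le> 0 \<Longrightarrow> v x = 0" "\<And>x. upwind (- k) h v x \<le> F.R v x" "1 - \<alpha> + \<epsilon> \<le> v r"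
      using F.subsolution_if_not_left_low[OF _ _ \<open>- k \<notin> F.left_low h r \<epsilon>\<close>] h r by auto
    \<comment> \<open>\<open>u\<close> is 0 on the left half-line and \<open>flip v\<close> is 1 on
      the right one, so the two are ordered without any comparison principle.\<close>
    have le: "u x \<le> flip v x" for x
      using u(2)[of x] v(2)[of "- x"] profileD[OF u(1), of x] profileD[OF v(1), of "- x"]
      by (cases "x \<le> 0") (auto simp: flip_def)
    have super: "R (flip v) x \<le> upwind k h (flip v) x" for x
      unfolding upwind_of_flip rhs_of_flip[OF v(1)] using v(3)[of "- x"] by simp
    obtain \<phi> where \<phi>: "profile \<phi>" "\<And>x. upwind k h \<phi> x = R \<phi> x" "\<And>x. u x \<le> \<phi> x" "\<And>x. \<phi> x \<le> flip v x"
      by (rule solution_between[OF u(1) profile_flip[OF v(1)] le u(3) super]) blast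
    have lo: "\<phi> (- r) \<le> \<alpha> - \<epsilon>" using \<phi>(4)[of "- r"] v(4) by (simp add: flip_def)
    have hi: "\<alpha> + \<epsilon> \<le> \<phi> r" using \<phi>(3)[of r] u(4) by simp
    have "(\<phi> \<longlongrightarrow> 0) at_bot" using entire_at_bot[OF \<phi>(1,2), of "- r"] lo e by simp
    then have "\<forall>\<^sub>F x in at_bot. \<phi> x < \<alpha> / 2" by (rule order_tendstoD) (use al in auto)
    \<comment> \<open>The distance \<open>2 * r\<close> places \<open>a + r\<close> to the left of
      \<open>- r\<close>, where the bound by \<open>\<alpha> - \<epsilon>\<close> is known;
      \<open>b\<close> is chosen symmetrically.\<close>
    then obtain a where a: "a \<le> - (2 * r)" "\<phi> a < \<alpha> / 2"
      using eventually_happens[OF eventually_conj[OF eventually_le_at_bot[of "- (2 * r)"]]] by (metis trivial_limit_at_bot_linorder)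
    have "(flip \<phi> \<longlongrightarrow> 0) at_bot"
      by (rule F.entire_at_bot[OF profile_flip[OF \<phi>(1)], of "- k" h "- r"])
        (use \<phi>(2) hi e in \<open>auto simp: upwind_flip rhs_flip[OF \<phi>(1)] flip_def\<close>)
    then have "(\<phi> \<longlongrightarrow> 1) at_top" using flip_at_top by fastforce
    then have "\<forall>\<^sub>F x in at_top. (1 + \<alpha>) / 2 < \<phi> x" by (rule order_tendstoD) (use al in auto)
    then obtain b where b: "2 * r \<le> b" "(1 + \<alpha>) / 2 < \<phi> b"
      using eventually_happens[OF eventually_conj[OF eventually_ge_at_top[of "2 * r"]]] by (metis trivial_limit_at_top_linorder)
    have "\<phi> (a + r) \<le> \<phi> (- r)" "\<phi> r \<le> \<phi> (b - r)" using a b r by (auto intro!: profileD(1)[OF \<phi>(1)])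
    then have "approx_front h r \<epsilon> k a b \<phi>"
      unfolding approx_front_def using \<phi>(1,2) lo hi a b e by auto
    then show ?thesis by blast
  qed
qed

end

section \<open>The weak formulation and the bound on the speed\<close>

lemma bounded_measurable_integrable_on:
  fixes g :: "real \<Rightarrow> real"
  assumes "g \<in> borel_measurable borel" "\<And>x. \<bar>g x\<bar> \<le> B"
  shows "g integrable_on {x..y}"
proof -
  have "set_integrable lborel {x..y} g"
    unfolding set_integrable_def
    by (rule integrableI_bounded_set_indicator[where B=B]) (use assms in \<open>auto simp: emeasure_lborel_Icc_eq\<close>)
  then show ?thesis by (rule set_borel_integral_eq_integral)
qed

lemma profile_integrable_on: "profile \<phi> \<Longrightarrow> \<phi> integrable_on {x..y}"
  by (rule bounded_measurable_integrable_on[where B=1]) (use profile_measurable profileD in \<open>auto simp: abs_le_iff\<close>)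

lemma profile_integral_le:
  assumes "profile \<phi>" "x \<le> y" "\<And>s. x \<le> s \<Longrightarrow> s \<le> y \<Longrightarrow> \<phi> s \<le> B"
  shows "integral {x..y} \<phi> \<le> (y - x) * B"
  using integral_le[of \<phi> "{x..y}" "\<lambda>_. B"] profile_integrable_on[OF assms(1)] assms by auto

lemma profile_integral_ge:
  assumes "profile \<phi>" "x \<le> y" "\<And>s. x \<le> s \<Longrightarrow> s \<le> y \<Longrightarrow> B \<le> \<phi> s"
  shows "(y - x) * B \<le> integral {x..y} \<phi>"
  using integral_le[of "\<lambda>_. B" "{x..y}" \<phi>] profile_integrable_on[OF assms(1)] assms by auto

lemma integral_shift_ivl: "integral {x..y} (\<lambda>s. \<phi> (s + c)) = integral {x + c..y + c} \<phi>" for \<phi> :: "real \<Rightarrow> real"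
  using integral_shift_Icc_real[of x y \<phi> c] by (simp add: o_def add.commute)

lemma integral_backward_difference:
  assumes P: "profile \<phi>" and h: "0 \<le> h" and xy: "x \<le> y"
  shows "integral {x..y} (\<lambda>s. \<phi> s - \<phi> (s - h)) = integral {y - h..y} \<phi> - integral {x - h..x} \<phi>"
proof -
  have "integral {x..y} (\<lambda>s. \<phi> s - \<phi> (s - h)) = integral {x..y} \<phi> - integral {x..y} (\<lambda>s. \<phi> (s + - h))"
    by (subst integral_diff) (use profile_integrable_on[OF P] profile_integrable_on[OF profile_shift[OF P, of "- h"]] in auto)
  also have "integral {x..y} (\<lambda>s. \<phi> (s + - h)) = integral {x - h..y - h} \<phi>"
    by (subst integral_shift_ivl) simp
  also have "integral {x..y} \<phi> - \<dots> = integral {y - h..y} \<phi> - integral {x - h..x} \<phi>"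
  proof -
    have "integral {x - h..x} \<phi> + integral {x..y} \<phi> = integral {x - h..y} \<phi>"
      by (rule Henstock_Kurzweil_Integration.integral_combine) (use h xy profile_integrable_on[OF P] in auto)
    moreover have "integral {x - h..y - h} \<phi> + integral {y - h..y} \<phi> = integral {x - h..y} \<phi>"
      by (rule Henstock_Kurzweil_Integration.integral_combine) (use h xy profile_integrable_on[OF P] in auto)
    ultimately show ?thesis by simp
  qed
  finally show ?thesis .
qed

lemma integral_backward_difference_le:
  assumes P: "profile \<phi>" and h: "0 \<le> h" and xy: "x \<le> y"
  shows "integral {x..y} (\<lambda>s. \<phi> s - \<phi> (s - h)) \<le> h * (\<phi> y - \<phi> (x - h))"
proof -
  have "integral {y - h..y} \<phi> \<le> (y - (y - h)) * \<phi> y"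
    by (rule profile_integral_le[OF P]) (use h profileD(1)[OF P] in auto)
  moreover have "(x - (x - h)) * \<phi> (x - h) \<le> integral {x - h..x} \<phi>"
    by (rule profile_integral_ge[OF P]) (use h profileD(1)[OF P] in auto)
  ultimately show ?thesis
    unfolding integral_backward_difference[OF assms] by (simp add: algebra_simps)
qed

lemma integral_forward_difference_ge:
  assumes P: "profile \<phi>" and h: "0 \<le> h" and xy: "x \<le> y"
  shows "h * (\<phi> y - \<phi> (x + h)) \<le> integral {x..y} (\<lambda>s. \<phi> (s + h) - \<phi> s)"
proof -
  have "integral {x..y} (\<lambda>s. \<phi> (s + h) - \<phi> s) = integral {x + h..y + h} (\<lambda>s. \<phi> s - \<phi> (s - h))"
    using integral_shift_ivl[of x y "\<lambda>s. \<phi> s - \<phi> (s - h)" h] by simp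
  also have "\<dots> = integral {y..y + h} \<phi> - integral {x..x + h} \<phi>"
    by (subst integral_backward_difference[OF P h]) (use xy in auto)
  finally have e: "integral {x..y} (\<lambda>s. \<phi> (s + h) - \<phi> s) = integral {y..y + h} \<phi> - integral {x..x + h} \<phi>" .
  have "(y + h - y) * \<phi> y \<le> integral {y..y + h} \<phi>"
    by (rule profile_integral_ge[OF P]) (use h profileD(1)[OF P] in auto)
  moreover have "integral {x..x + h} \<phi> \<le> (x + h - x) * \<phi> (x + h)"
    by (rule profile_integral_le[OF P]) (use h profileD(1)[OF P] in auto)
  ultimately show ?thesis unfolding e by (simp add: algebra_simps)
qed

text \<open>The integrated differences telescope to windows of length \<open>h\<close> at the two
  ends, which monotonicity replaces by endpoint values. The mesh then enters only through the speed
  \<open>k * h\<close> and the displaced arguments, so a limit in \<open>h\<close> is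
  possible.\<close>

lemma integral_upwind_le:
  assumes P: "profile \<phi>" and h: "0 \<le> h" and xy: "x \<le> y"
  shows "upwind k h \<phi> integrable_on {x..y}"
    and "integral {x..y} (upwind k h \<phi>) \<le> max (k * h) 0 * (\<phi> y - \<phi> (x - h)) - max (- (k * h)) 0 * (\<phi> y - \<phi> (x + h))"
proof -
  have i: "(\<lambda>s. \<phi> s - \<phi> (s - h)) integrable_on {x..y}" "(\<lambda>s. \<phi> (s + h) - \<phi> s) integrable_on {x..y}"
    using profile_integrable_on[OF P] profile_integrable_on[OF profile_shift[OF P, of h]]
      profile_integrable_on[OF profile_shift[OF P, of "- h"]] by (auto intro!: integrable_diff)
  note i' = integrable_on_cmult_left[OF i(1), of "max k 0"] integrable_on_cmult_left[OF i(2), of "max (- k) 0"]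
  show "upwind k h \<phi> integrable_on {x..y}"
    unfolding upwind_def[abs_def] using i' by (auto intro!: integrable_diff)
  have "integral {x..y} (upwind k h \<phi>) = max k 0 * integral {x..y} (\<lambda>s. \<phi> s - \<phi> (s - h))
      - max (- k) 0 * integral {x..y} (\<lambda>s. \<phi> (s + h) - \<phi> s)"
    unfolding upwind_def[abs_def] using i' by (subst integral_diff) auto
  also have "\<dots> \<le> max k 0 * (h * (\<phi> y - \<phi> (x - h))) - max (- k) 0 * (h * (\<phi> y - \<phi> (x + h)))"
    by (intro diff_mono mult_left_mono integral_backward_difference_le integral_forward_difference_ge assms) auto
  also have "\<dots> = max (k * h) 0 * (\<phi> y - \<phi> (x - h)) - max (- (k * h)) 0 * (\<phi> y - \<phi> (x + h))"
  proof -
    have "max (k * h) 0 = max k 0 * h" "max (- (k * h)) 0 = max (- k) 0 * h"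
      using h by (simp_all add: max_mult_distrib_right)
    then show ?thesis by (simp only: mult.assoc)
  qed
  finally show "integral {x..y} (upwind k h \<phi>) \<le> max (k * h) 0 * (\<phi> y - \<phi> (x - h)) - max (- (k * h)) 0 * (\<phi> y - \<phi> (x + h))" .
qed

text \<open>Weak form of \<open>\<mu> * \<phi> - \<phi> + f(\<phi>) \<le> c \<phi>'\<close>; for \<open>c = 0\<close> no regularity of \<open>\<phi>\<close> is forced.\<close>

definition weak_super :: "real measure \<Rightarrow> (real \<Rightarrow> real) \<Rightarrow> real \<Rightarrow> (real \<Rightarrow> real) \<Rightarrow> bool" where
  "weak_super \<mu> f c \<phi> \<longleftrightarrow> (\<forall>x y. x < y \<longrightarrow> integral {x..y} (rhs \<mu> f \<phi>) \<le> c * (\<phi> y - \<phi> x))"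

section \<open>The limit of vanishing mesh\<close>

context bistable begin

lemma rhs_integrable_on: "profile \<phi> \<Longrightarrow> R \<phi> integrable_on {x..y}"
  by (rule bounded_measurable_integrable_on[OF rhs_measurable rhs_bound])

lemma rhs_integral_bound: assumes "profile \<phi>" "x \<le> y" shows "\<bar>integral {x..y} (R \<phi>)\<bar> \<le> (1 + L) * (y - x)"
proof -
  have "integral {x..y} (R \<phi>) \<le> integral {x..y} (\<lambda>_. 1 + L)" "integral {x..y} (\<lambda>_. - (1 + L)) \<le> integral {x..y} (R \<phi>)"
    using rhs_bound[OF assms(1)]
    by (auto intro!: integral_le rhs_integrable_on assms simp del: integral_const_real simp: abs_le_iff minus_le_iff)
  then show ?thesis using assms(2) by (simp add: algebra_simps abs_le_iff)
qed

lemma rhs_integral_combine: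
  assumes "profile \<phi>" "x \<le> y" "y \<le> z"
  shows "integral {x..y} (R \<phi>) + integral {y..z} (R \<phi>) = integral {x..z} (R \<phi>)"
  by (rule Henstock_Kurzweil_Integration.integral_combine) (use assms rhs_integrable_on in auto)

lemma rhs_integral_lim:
  assumes "\<And>n. profile (\<phi> n)" "\<And>x. (\<lambda>n. \<phi> n x) \<longlonglongrightarrow> \<psi> x"
  shows "(\<lambda>n. integral {x..y} (R (\<phi> n))) \<longlonglongrightarrow> integral {x..y} (R \<psi>)"
  by (rule dominated_convergence(2)[where h="\<lambda>_. 1 + L"])
    (use rhs_integrable_on rhs_bound rhs_lim[OF assms] assms(1) in auto)

text \<open>At the points \<open>x - h\<close> and \<open>x + h\<close> pointwise convergence says
  nothing, so they are first replaced by fixed points \<open>s < x < t\<close>. To recover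
  \<open>x\<close> itself, the left endpoint of integration moves by \<open>d\<close>: to the right
  with \<open>s\<close> at the original \<open>x\<close> if c \<ge> 0, to the left with
  \<open>t\<close> there if c < 0. Boundedness of \<open>R\<close> makes the error at most
  \<open>(1 + L) * d\<close>.\<close>

lemma weak_super_lim:
  assumes P: "\<And>n. profile (\<phi> n)" and lim: "\<And>x. (\<lambda>n. \<phi> n x) \<longlonglongrightarrow> \<psi> x"
    and h: "\<And>n. 0 < h n" "h \<longlonglongrightarrow> 0" and c: "(\<lambda>n. k n * h n) \<longlonglongrightarrow> c"
    and A: "filterlim A at_bot sequentially"
    and super: "\<And>n x. A n < x \<Longrightarrow> R (\<phi> n) x \<le> upwind (k n) (h n) (\<phi> n) x"
  shows "weak_super \<mu> f c \<psi>"
proof -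
  have P': "profile \<psi>" by (rule profile_lim[OF P lim])
  have ineq: "integral {x..y} (R \<psi>) \<le> max c 0 * (\<psi> y - \<psi> s) - max (- c) 0 * (\<psi> y - \<psi> t)"
    if "s < x" "x < t" "x \<le> y" for s t x y
  proof (rule tendsto_le[OF _ _ rhs_integral_lim[OF P lim]])
    show "(\<lambda>n. max (k n * h n) 0 * (\<phi> n y - \<phi> n s) - max (- (k n * h n)) 0 * (\<phi> n y - \<phi> n t))
        \<longlonglongrightarrow> max c 0 * (\<psi> y - \<psi> s) - max (- c) 0 * (\<psi> y - \<psi> t)"
      by (intro tendsto_intros c lim)
    have "\<forall>\<^sub>F n in sequentially. h n < x - s" "\<forall>\<^sub>F n in sequentially. h n < t - x"
      using order_tendstoD(2)[OF h(2)] that by auto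
    moreover have "\<forall>\<^sub>F n in sequentially. A n < x"
      using filterlim_at_bot_dense[THEN iffD1, OF A] by blast
    ultimately show "\<forall>\<^sub>F n in sequentially. integral {x..y} (R (\<phi> n))
        \<le> max (k n * h n) 0 * (\<phi> n y - \<phi> n s) - max (- (k n * h n)) 0 * (\<phi> n y - \<phi> n t)"
    proof eventually_elim
      case (elim n)
      have "integral {x..y} (R (\<phi> n)) \<le> integral {x..y} (upwind (k n) (h n) (\<phi> n))"
        using h(1)[of n] that elim
        by (intro integral_le rhs_integrable_on integral_upwind_le(1) P super) auto
      also have "\<dots> \<le> max (k n * h n) 0 * (\<phi> n y - \<phi> n (x - h n)) - max (- (k n * h n)) 0 * (\<phi> n y - \<phi> n (x + h n))"
        using h(1)[of n] that by (intro integral_upwind_le(2) P) auto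
      also have "\<dots> \<le> max (k n * h n) 0 * (\<phi> n y - \<phi> n s) - max (- (k n * h n)) 0 * (\<phi> n y - \<phi> n t)"
        using elim by (intro diff_mono mult_left_mono profileD(1)[OF P] order.refl) auto
      finally show ?case .
    qed
  qed simp
  show ?thesis
    unfolding weak_super_def
  proof (intro allI impI)
    fix x y :: real assume xy: "x < y"
    show "integral {x..y} (R \<psi>) \<le> c * (\<psi> y - \<psi> x)"
    proof (rule field_le_epsilon)
      fix e :: real assume e: "0 < e"
      have L1: "0 < 1 + L" using L0 by simp
      define d where "d = min (y - x) (e / (1 + L))"
      have d: "0 < d" "d \<le> y - x" "(1 + L) * d \<le> e"
        using xy e L1 pos_le_divide_eq[OF L1, of d e] by (auto simp: d_def mult.commute)
      show "integral {x..y} (R \<psi>) \<le> c * (\<psi> y - \<psi> x) + e"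
      proof (cases "0 \<le> c")
        case True
        have "integral {x..y} (R \<psi>) = integral {x..x + d} (R \<psi>) + integral {x + d..y} (R \<psi>)"
          using d by (subst rhs_integral_combine[OF P']) auto
        moreover have "\<bar>integral {x..x + d} (R \<psi>)\<bar> \<le> (1 + L) * d"
          using rhs_integral_bound[OF P', of x "x + d"] d by simp
        moreover have "integral {x + d..y} (R \<psi>) \<le> c * (\<psi> y - \<psi> x)"
          using ineq[of x "x + d" "x + 2 * d" y] True d by simp
        ultimately show ?thesis using d by linarith
      next
        case False
        have "integral {x - d..y} (R \<psi>) = integral {x - d..x} (R \<psi>) + integral {x..y} (R \<psi>)"
          using d xy by (subst rhs_integral_combine[OF P']) auto
        moreover have "\<bar>integral {x - d..x} (R \<psi>)\<bar> \<le> (1 + L) * d"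
          using rhs_integral_bound[OF P', of "x - d" x] d by simp
        moreover have "integral {x - d..y} (R \<psi>) \<le> c * (\<psi> y - \<psi> x)"
          using ineq[of "x - 2 * d" "x - d" x y] False d xy by simp
        ultimately show ?thesis using d by linarith
      qed
    qed
  qed
qed

section \<open>An upper bound for the speed, uniform in the mesh\<close>

lemma tail_prob_small:
  assumes "0 < e" obtains l where "0 < l" "prob {z. l < \<bar>z\<bar>} < e"
proof -
  have "(\<lambda>n. prob {z. real n < \<bar>z\<bar>}) \<longlonglongrightarrow> prob (\<Inter>n. {z. real n < \<bar>z\<bar>})"
    by (rule finite_Lim_measure_decseq) (auto simp: decseq_def sets_mu)
  moreover have "(\<Inter>n. {z. real n < \<bar>z\<bar>}) = {}"
  proof (rule equals0I)
    fix x :: real assume x: "x \<in> (\<Inter>n. {z. real n < \<bar>z\<bar>})"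
    obtain n :: nat where "\<bar>x\<bar> < real n" using reals_Archimedean2 by blast
    then show False using x by (auto dest: spec[of _ n])
  qed
  ultimately have "\<forall>\<^sub>F n in sequentially. prob {z. real n < \<bar>z\<bar>} < e"
    using order_tendstoD(2)[of _ 0 sequentially e] assms by simp
  then obtain n where n: "\<And>m. m \<ge> n \<Longrightarrow> prob {z. real m < \<bar>z\<bar>} < e" by (auto simp: eventually_sequentially)
  show thesis using that[of "real (Suc n)"] n[of "Suc n"] by simp
qed

lemma conv_le_shift:
  assumes P: "profile \<phi>" shows "conv \<mu> \<phi> s \<le> \<phi> (s + l) + prob {z. l < \<bar>z\<bar>}"
proof -
  note [measurable] = profile_measurable[OF P]
  have "conv \<mu> \<phi> s \<le> (\<integral>z. \<phi> (s + l) + indicator {z. l < \<bar>z\<bar>} z \<partial>\<mu>)"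
    unfolding conv_def
  proof (rule integral_mono[OF profile_integrable[OF P]])
    show "\<phi> (s - z) \<le> \<phi> (s + l) + indicator {z. l < \<bar>z\<bar>} z" for z
      using profileD[OF P] profileD(1)[OF P, of "s - z" "s + l"] by (auto simp: indicator_def add_increasing)
  qed (auto intro!: integrable_real_indicator simp: sets_mu emeasure_eq_measure)
  also have "\<dots> = \<phi> (s + l) + prob {z. l < \<bar>z\<bar>}"
    using prob_space by (subst Bochner_Integration.integral_add)
      (auto intro!: integrable_real_indicator simp: sets_mu emeasure_eq_measure)
  finally show ?thesis .
qed

text \<open>A very fast front is nearly flat. Just above the level \<alpha> / 2 it would stay in a
  range where \<open>f\<close> is strictly negative over a distance capturing most of
  \<open>\<mu>\<close>, making \<open>R\<close> negative, whereas the upwind term of a monotone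
  profile is nonnegative. Reflection supplies the lower bound.\<close>

lemma speed_bound:
  obtains C r0 where "\<And>h r \<epsilon> k a b \<phi>. 0 < h \<Longrightarrow> h \<le> 1 \<Longrightarrow> r0 \<le> r \<Longrightarrow> \<epsilon> \<le> \<alpha> / 4 \<Longrightarrow> approx_front h r \<epsilon> k a b \<phi> \<Longrightarrow> k * h \<le> C"
proof -
  \<comment> \<open>The maximum of \<open>f\<close> on this compact subinterval of (0, \<alpha>)
    gives a uniform bound \<open>- m\<close> there.\<close>
  have "\<exists>u\<in>{\<alpha>/2..3*\<alpha>/4}. \<forall>v\<in>{\<alpha>/2..3*\<alpha>/4}. f v \<le> f u"
    by (rule continuous_attains_sup) (use al continuous_on_subset[OF f_cont] in auto)
  then obtain u where u: "u \<in> {\<alpha>/2..3*\<alpha>/4}" "\<And>v. v \<in> {\<alpha>/2..3*\<alpha>/4} \<Longrightarrow> f v \<le> f u" by blast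
  define m where "m = - f u"
  have m: "0 < m" unfolding m_def using fneg[of u] u(1) al by auto
  obtain l where l: "0 < l" "prob {z. l < \<bar>z\<bar>} < m / 4" using tail_prob_small[of "m / 4"] m by auto
  \<comment> \<open>One entry keeps values below 3\<alpha>/4; the other, with the tail mass below
    \<open>m / 4\<close>, leaves \<open>R\<close> negative. \<open>C\<close> then limits the rise
    over a distance \<open>l + 3\<close> to \<open>\<sigma>\<close>.\<close>
  define \<sigma> where "\<sigma> = min (\<alpha> / 4) (m / 4)"
  have s0: "0 < \<sigma>" using al m by (simp add: \<sigma>_def)
  define C where "C = (l + 3) * (1 + L) / \<sigma>"
  have C0: "0 < C" unfolding C_def using l L0 s0 by auto
  have "k * h \<le> C" if h: "0 < h" "h \<le> 1" and r: "l + 4 \<le> r" and e: "\<epsilon> \<le> \<alpha> / 4" and ap: "approx_front h r \<epsilon> k a b \<phi>" for h r \<epsilon> k a b \<phi>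
  proof (rule ccontr)
    assume "\<not> k * h \<le> C"
    then have kh: "C < k * h" by simp
    then have k0: "0 < k" using C0 h by (metis less_trans zero_less_mult_pos2)
    have P: "profile \<phi>" and sub: "\<And>x. x < b \<Longrightarrow> upwind k h \<phi> x \<le> R \<phi> x"
      and ar: "\<alpha> - \<epsilon> \<le> \<phi> (b - r)" and a: "\<phi> a \<le> \<alpha> / 2"
      using ap by (auto simp: approx_front_def)
    have sub': "k * (\<phi> x - \<phi> (x - h)) \<le> R \<phi> x" if "x < b" for x
      using sub[OF that] k0 by (simp add: upwind_def)
    \<comment> \<open>The supremum \<open>y\<close> need not be attained, hence the nearby
      \<open>y'\<close> in the set as a starting point and \<open>y + 1\<close> as a point surely
      beyond the level.\<close>
    let ?S = "{x. \<phi> x \<le> \<alpha> / 2}"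
    have ub: "x \<le> b - r" if "x \<in> ?S" for x
      using that profileD(1)[OF P, of "b - r" x] ar e al by (cases "x \<le> b - r") auto
    have bdd: "bdd_above ?S" using ub by (rule bdd_aboveI)
    have ne: "?S \<noteq> {}" using a by auto
    define y where "y = Sup ?S"
    have y: "y \<le> b - r" unfolding y_def using ne ub by (rule cSup_least)
    obtain y' where y': "y' \<in> ?S" "y - 1 < y'" using less_cSupE[OF _ ne, of "y - 1"] unfolding y_def by auto
    have y'y: "y' \<le> y" unfolding y_def using y'(1) bdd by (rule cSup_upper)
    have it: "y' + real i * h < b \<Longrightarrow> \<phi> (y' + real i * h) \<le> \<alpha> / 2 + real i * (1 + L) / k" for i
    proof (induction i)
      case 0
      then show ?case using y' by simp
    next
      case (Suc i)
      have e: "y' + real (Suc i) * h - h = y' + real i * h" by (simp add: algebra_simps)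
      have "k * (\<phi> (y' + real (Suc i) * h) - \<phi> (y' + real i * h)) \<le> 1 + L"
        using sub'[OF Suc.prems] rhs_bound[OF P, of "y' + real (Suc i) * h"] unfolding e by linarith
      then have "\<phi> (y' + real (Suc i) * h) \<le> \<phi> (y' + real i * h) + (1 + L) / k" using k0 by (simp add: field_simps)
      moreover have "\<phi> (y' + real i * h) \<le> \<alpha> / 2 + real i * (1 + L) / k"
        by (rule Suc.IH) (use Suc.prems h in \<open>auto simp: algebra_simps\<close>)
      ultimately show ?case by (simp add: add_divide_distrib distrib_right)
    qed
    \<comment> \<open>Steps of length \<open>h\<close> from \<open>y'\<close> must reach
      \<open>y + 1 + l\<close>, a distance less than \<open>l + 2\<close>; rounding overshoots by at
      most \<open>h\<close>, hence at most 1, and r \<ge> l + 4 keeps the endpoint left of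
      \<open>b\<close>.\<close>
    define j where "j = nat \<lceil>(l + 2) / h\<rceil>"
    have "(l + 2) / h \<le> real j" "real j \<le> (l + 2) / h + 1"
      unfolding j_def using l h by (auto simp: of_nat_nat)
    then have j: "l + 2 \<le> real j * h" "real j * h \<le> l + 3" using h by (auto simp: field_simps)
    have "y' + real j * h < b" using y'y y r j by linarith
    then have "\<phi> (y' + real j * h) \<le> \<alpha> / 2 + real j * (1 + L) / k" by (rule it)
    also have "real j * (1 + L) / k = (real j * h) * (1 + L) / (k * h)" using h by simp
    also have "\<dots> \<le> (l + 3) * (1 + L) / C"
      by (intro frac_le mult_right_mono) (use j L0 l C0 kh in auto)
    also have "\<dots> = \<sigma>" unfolding C_def using l L0 s0 by simp
    finally have top: "\<phi> (y' + real j * h) \<le> \<alpha> / 2 + \<sigma>" by simp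
    define s where "s = y + 1"
    have "s \<notin> ?S"
    proof
      assume "s \<in> ?S"
      from cSup_upper[OF this bdd] show False by (simp add: s_def y_def)
    qed
    then have lo: "\<alpha> / 2 < \<phi> s" by simp
    have sl: "\<phi> (s + l) \<le> \<alpha> / 2 + \<sigma>"
      using profileD(1)[OF P, of "s + l" "y' + real j * h"] top y' j by (auto simp: s_def)
    have "\<phi> s \<le> \<phi> (s + l)" using l by (intro profileD(1)[OF P]) simp
    then have "\<phi> s \<in> {\<alpha>/2..3*\<alpha>/4}" using lo sl by (auto simp: \<sigma>_def min_def split: if_splits)
    then have "f (\<phi> s) \<le> - m" using u(2) by (simp add: m_def)
    moreover have "conv \<mu> \<phi> s \<le> \<phi> (s + l) + prob {z. l < \<bar>z\<bar>}" by (rule conv_le_shift[OF P])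
    ultimately have "R \<phi> s < 0"
      unfolding rhs_def using sl lo l(2) \<sigma>_def m by linarith
    moreover have "0 \<le> k * (\<phi> s - \<phi> (s - h))"
      using k0 profileD(1)[OF P, of "s - h" s] h by simp
    ultimately show False using sub'[of s] y r l by (simp add: s_def)
  qed
  then show thesis using that by blast
qed

end

section \<open>Passage to the limit\<close>

context bistable begin

lemma zero_below:
  assumes "f l = 0" "0 \<le> l" "l \<le> (1 + \<alpha>) / 2" shows "l = 0 \<or> l = \<alpha>"
proof (rule ccontr)
  assume "\<not> (l = 0 \<or> l = \<alpha>)"
  then have "0 < l \<and> l < \<alpha> \<or> \<alpha> < l \<and> l < 1" using assms al by (auto simp: field_simps)
  then show False using fneg[of l] fpos[of l] assms(1) by auto
qed

text \<open>Over unit windows travelling with \<open>\<sigma>\<close> the integral of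
  \<open>R\<close> tends to \<open>f l\<close>, while the increment of \<open>\<phi>\<close> tends
  to 0.\<close>

lemma weak_super_limit:
  assumes P: "profile \<phi>" and W: "weak_super \<mu> f c \<phi>" and lim: "\<And>x. (\<lambda>n. \<phi> (x + \<sigma> n)) \<longlonglongrightarrow> l"
  shows "f l \<le> 0"
proof -
  have "(\<lambda>n. integral {0..1} (R (\<lambda>x. \<phi> (x + \<sigma> n)))) \<longlonglongrightarrow> integral {0..1} (R (\<lambda>_. l))"
    by (rule rhs_integral_lim[OF profile_shift[OF P] lim])
  then have 1: "(\<lambda>n. integral {\<sigma> n..1 + \<sigma> n} (R \<phi>)) \<longlonglongrightarrow> f l"
    unfolding rhs_shift[abs_def] integral_shift_ivl rhs_const[abs_def] by simp
  have "(\<lambda>n. c * (\<phi> (1 + \<sigma> n) - \<phi> (0 + \<sigma> n))) \<longlonglongrightarrow> c * (l - l)"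
    by (intro tendsto_intros lim)
  then have 2: "(\<lambda>n. c * (\<phi> (1 + \<sigma> n) - \<phi> (\<sigma> n))) \<longlonglongrightarrow> 0" by simp
  show ?thesis
    by (rule LIMSEQ_le[OF 1 2]) (use W in \<open>auto simp: weak_super_def\<close>)
qed

text \<open>Reflection turns subsolutions into supersolutions, so the second weak condition is the
  reverse inequality: together they state the integrated profile equation.\<close>

definition wave :: "real \<Rightarrow> (real \<Rightarrow> real) \<Rightarrow> bool" where
  "wave c \<phi> \<longleftrightarrow> profile \<phi> \<and> weak_super \<mu> f c \<phi> \<and> weak_super \<mu>' f' (- c) (flip \<phi>)
     \<and> (\<phi> \<longlongrightarrow> 0) at_bot \<and> (\<phi> \<longlongrightarrow> 1) at_top"

lemma wave_of_flip:
  assumes "bistable.wave \<mu>' f' (- c) \<phi>" shows "wave c (flip \<phi>)"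
proof -
  interpret F: bistable \<mu>' f' "1 - \<alpha>" L \<kappa> \<delta> by (rule bistable_flip)
  have w: "profile \<phi>" "weak_super \<mu>' f' (- c) \<phi>" "weak_super \<mu> f c (flip \<phi>)" "(\<phi> \<longlongrightarrow> 0) at_bot" "(\<phi> \<longlongrightarrow> 1) at_top"
    using assms unfolding F.wave_def by simp_all
  have "((\<lambda>x. \<phi> (- x)) \<longlongrightarrow> 1) at_bot"
    by (rule filterlim_compose[OF w(5) filterlim_uminus_at_top_at_bot])
  then have "((\<lambda>x. 1 - \<phi> (- x)) \<longlongrightarrow> 1 - 1) at_bot" by (intro tendsto_intros)
  then have "(flip \<phi> \<longlongrightarrow> 0) at_bot" by (simp add: flip_def[abs_def])
  moreover have "(flip \<phi> \<longlongrightarrow> 1) at_top" using flip_at_top[of "flip \<phi>" 0] w(4) by simp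
  ultimately show ?thesis unfolding wave_def using w profile_flip by simp
qed

text \<open>With the crossing of (1 + \<alpha>) / 2 moved to the origin, the left end always
  recedes. If the right end recedes too, the limit solves the equation and joins 0 or
  \<open>\<alpha>\<close> to 1. If not, it is still a supersolution, and the bound at
  \<open>b - r\<close> keeps it above \<open>\<alpha>\<close>.\<close>

lemma right_piece:
  assumes ap: "\<And>n. approx_front (h n) (r n) (\<epsilon> n) (k n) (a n) (b n) (\<phi> n)"
    and h: "\<And>n. 0 < h n" "h \<longlonglongrightarrow> 0" and r: "filterlim r at_top sequentially"
    and e: "\<epsilon> \<longlonglongrightarrow> 0" and c: "(\<lambda>n. k n * h n) \<longlonglongrightarrow> c"
  shows "(\<exists>\<psi>. wave c \<psi>) \<or>
    (\<exists>\<psi>. profile \<psi> \<and> weak_super \<mu> f c \<psi> \<and> (\<psi> \<longlongrightarrow> \<alpha>) at_bot \<and> (\<forall>x>0. (1 + \<alpha>) / 2 \<le> \<psi> x))"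
proof -
  interpret F: bistable \<mu>' f' "1 - \<alpha>" L \<kappa> \<delta> by (rule bistable_flip)
  define p where "p = (1 + \<alpha>) / 2"
  have p: "\<alpha> < p" "p < 1" "\<alpha> / 2 < p" unfolding p_def using al by auto
  have P: "profile (\<phi> n)" and super: "\<And>x. a n < x \<Longrightarrow> R (\<phi> n) x \<le> upwind (k n) (h n) (\<phi> n) x"
    and sub: "\<And>x. x < b n \<Longrightarrow> upwind (k n) (h n) (\<phi> n) x \<le> R (\<phi> n) x"
    and ar: "\<phi> n (a n + r n) \<le> \<alpha> + \<epsilon> n" and br: "\<alpha> - \<epsilon> n \<le> \<phi> n (b n - r n)"
    and a: "\<phi> n (a n) \<le> \<alpha> / 2" and b: "p \<le> \<phi> n (b n)" for n
    using ap[of n] by (auto simp: approx_front_def p_def)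
  define \<xi> where "\<xi> n = Inf {x. p \<le> \<phi> n x}" for n
  have above: "z \<le> x" if "p \<le> \<phi> n x" "\<phi> n z < p" for n x z
    using that profileD(1)[OF P[of n], of x z] by (cases "z \<le> x") auto
  have bdd: "bdd_below {x. p \<le> \<phi> n x}" for n
    by (rule bdd_belowI[of _ "a n"]) (use above[of n _ "a n"] a[of n] p in auto)
  have xi_le: "\<xi> n \<le> x" if "p \<le> \<phi> n x" for n x
    unfolding \<xi>_def by (rule cInf_lower[OF _ bdd]) (use that in auto)
  have xi_ge: "z \<le> \<xi> n" if "\<phi> n z < p" for n z
    unfolding \<xi>_def by (rule cInf_greatest) (use b[of n] above that in auto)
  have right: "p \<le> \<phi> n x" if "\<xi> n < x" for n x
    using xi_ge[of n x] that by (cases "p \<le> \<phi> n x") auto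
  have left: "\<phi> n x < p" if "x < \<xi> n" for n x
    using xi_le[of n x] that by (cases "p \<le> \<phi> n x") auto
  define u where "u n x = \<phi> n (x + \<xi> n)" for n x
  have Pu: "profile (u n)" for n unfolding u_def by (rule profile_shift[OF P])
  have u_super: "R (u n) x \<le> upwind (k n) (h n) (u n) x" if "a n - \<xi> n < x" for n x
    unfolding u_def rhs_shift upwind_shift by (rule super) (use that in simp)
  have u_sub: "upwind (k n) (h n) (u n) x \<le> R (u n) x" if "x < b n - \<xi> n" for n x
    unfolding u_def rhs_shift upwind_shift by (rule sub) (use that in simp)
  \<comment> \<open>Eventually \<open>\<alpha> + \<epsilon> n < p\<close>, so the crossing lies
    beyond \<open>a n + r n\<close> and is separated from \<open>a n\<close> by at least
    \<open>r n\<close>.\<close>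
  have abot: "filterlim (\<lambda>n. a n - \<xi> n) at_bot sequentially"
    unfolding filterlim_at_bot
  proof
    fix Z
    have "\<forall>\<^sub>F n in sequentially. \<epsilon> n < p - \<alpha>" by (rule order_tendstoD(2)[OF e]) (use p in simp)
    moreover have "\<forall>\<^sub>F n in sequentially. - Z \<le> r n" using r by (simp add: filterlim_at_top)
    ultimately show "\<forall>\<^sub>F n in sequentially. a n - \<xi> n \<le> Z"
    proof eventually_elim
      case (elim n)
      then show ?case using xi_ge[of n "a n + r n"] ar[of n] by linarith
    qed
  qed
  have key: "weak_super \<mu> f c \<psi> \<and> (\<forall>x<0. \<psi> x \<le> p) \<and> (\<forall>x>0. p \<le> \<psi> x)"
    if s: "strict_mono s" and lim: "\<And>x. (\<lambda>n. u (s n) x) \<longlonglongrightarrow> \<psi> x" for s \<psi>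
  proof (intro conjI allI impI)
    have sub: "filterlim s sequentially sequentially" by (rule filterlim_subseq[OF s])
    show "weak_super \<mu> f c \<psi>"
      by (rule weak_super_lim[where A="\<lambda>n. a (s n) - \<xi> (s n)", OF Pu lim h(1) filterlim_compose[OF h(2) sub]
            filterlim_compose[OF c sub] filterlim_compose[OF abot sub] u_super])
    show "\<psi> x \<le> p" if "x < 0" for x
      by (rule LIMSEQ_le_const2[OF lim]) (use that left in \<open>auto simp: u_def intro!: less_imp_le\<close>)
    show "p \<le> \<psi> x" if "0 < x" for x
      by (rule LIMSEQ_le_const[OF lim]) (use that right in \<open>auto simp: u_def\<close>)
  qed
  show ?thesis
  proof (cases "filterlim (\<lambda>n. b n - \<xi> n) at_top sequentially")
    case True
    obtain s \<psi> where s: "strict_mono s" and P': "profile \<psi>" and lim: "\<And>x. (\<lambda>n. u (s n) x) \<longlonglongrightarrow> \<psi> x"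
      by (rule profile_subsequence[of u, OF Pu]) blast
    note K = key[OF s lim]
    have sub: "filterlim s sequentially sequentially" by (rule filterlim_subseq[OF s])
    have W': "weak_super \<mu>' f' (- c) (flip \<psi>)"
    proof (rule F.weak_super_lim[where \<phi>="\<lambda>n. flip (u (s n))" and h="\<lambda>n. h (s n)" and k="\<lambda>n. - k (s n)"
          and A="\<lambda>n. - (b (s n) - \<xi> (s n))"])
      show "(\<lambda>n. flip (u (s n)) x) \<longlonglongrightarrow> flip \<psi> x" for x
        unfolding flip_def by (intro tendsto_intros lim)
      show "(\<lambda>n. h (s n)) \<longlonglongrightarrow> 0" by (rule filterlim_compose[OF h(2) sub])
      show "(\<lambda>n. - k (s n) * h (s n)) \<longlonglongrightarrow> - c"
        using tendsto_minus[OF filterlim_compose[OF c sub]] by simp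
      show "filterlim (\<lambda>n. - (b (s n) - \<xi> (s n))) at_bot sequentially"
        using filterlim_compose[OF True sub] by (simp add: filterlim_uminus_at_top)
      show "rhs \<mu>' f' (flip (u (s n))) x \<le> upwind (- k (s n)) (h (s n)) (flip (u (s n))) x"
        if "- (b (s n) - \<xi> (s n)) < x" for n x
        unfolding rhs_flip[OF Pu] upwind_flip using u_sub[of "- x" "s n"] that by simp
    qed (use Pu h profile_flip in auto)
    obtain l where l: "(\<psi> \<longlongrightarrow> l) at_bot" "\<And>x. l \<le> \<psi> x" "0 \<le> l" using profile_at_bot[OF P'] by blast
    obtain l' where l': "(flip \<psi> \<longlongrightarrow> l') at_bot" "\<And>x. l' \<le> flip \<psi> x" "0 \<le> l'"
      using profile_at_bot[OF profile_flip[OF P']] by blast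
    have top: "(\<psi> \<longlongrightarrow> 1 - l') at_top" by (rule flip_at_top[OF l'(1)])
    have at_top_lim: "(\<lambda>n. g (x + real n)) \<longlonglongrightarrow> z" if "(g \<longlongrightarrow> z) at_top" for g and x z :: real
      by (rule filterlim_compose[OF that filterlim_tendsto_add_at_top[OF tendsto_const filterlim_real_sequentially]])
    have flip_top: "(flip \<psi> \<longlongrightarrow> 1 - l) at_top" using flip_at_top[of "flip \<psi>" l] l(1) by simp
    \<comment> \<open>At either end the two weak inequalities give \<open>f\<close> of the limit
      both signs, hence a zero; the normalisation at the origin decides which zeros remain.\<close>
    have "f l \<le> 0" by (rule weak_super_limit[OF P' _ shift_to_bot[OF l(1)]]) (use K in blast)
    moreover have "f' (1 - l) \<le> 0" by (rule F.weak_super_limit[OF profile_flip[OF P'] W' at_top_lim[OF flip_top]])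
    ultimately have "f l = 0" by simp
    moreover have "l \<le> p" using l(2)[of "-1"] K[THEN conjunct2, THEN conjunct1, rule_format, of "-1"] by simp
    ultimately have "l = 0 \<or> l = \<alpha>" using zero_below[OF _ l(3)] by (simp add: p_def)
    have "f' l' \<le> 0" by (rule F.weak_super_limit[OF profile_flip[OF P'] W' shift_to_bot[OF l'(1)]])
    moreover have "f (1 - l') \<le> 0" by (rule weak_super_limit[OF P' _ at_top_lim[OF top]]) (use K in blast)
    ultimately have "f' l' = 0" by simp
    moreover have "l' \<le> 1 - p" using l'(2)[of "-1"] K[THEN conjunct2, THEN conjunct2, rule_format, of 1] by (simp add: flip_def)
    ultimately have "l' = 0" using F.zero_below[OF _ l'(3)] al by (simp add: p_def field_simps)
    then have "(\<psi> \<longlongrightarrow> 1) at_top" using top by simp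
    then show ?thesis
      using \<open>l = 0 \<or> l = \<alpha>\<close> l(1) K W' P' unfolding wave_def p_def by blast
  next
    case False
    then obtain D where D: "\<not> (\<forall>\<^sub>F n in sequentially. D \<le> b n - \<xi> n)" by (auto simp: filterlim_at_top)
    obtain s0 :: "nat \<Rightarrow> nat" where s0: "strict_mono s0" "\<And>n. b (s0 n) - \<xi> (s0 n) < D"
      using not_eventually_sequentiallyD[OF D] unfolding not_le by blast
    obtain s1 \<psi> where s1: "strict_mono s1" and P': "profile \<psi>" and lim: "\<And>x. (\<lambda>n. u (s0 (s1 n)) x) \<longlonglongrightarrow> \<psi> x"
      by (rule profile_subsequence[of "\<lambda>n. u (s0 n)", OF Pu]) blast
    define s where "s = s0 \<circ> s1"
    have s: "strict_mono s" unfolding s_def by (rule strict_mono_o[OF s0(1) s1])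
    have lim': "(\<lambda>n. u (s n) x) \<longlonglongrightarrow> \<psi> x" for x using lim by (simp add: s_def)
    note K = key[OF s lim']
    have sub: "filterlim s sequentially sequentially" by (rule filterlim_subseq[OF s])
    \<comment> \<open>In moving coordinates \<open>b - r\<close> lies left of \<open>D - r\<close>,
      which tends to -\<infinity>, so every fixed \<open>x\<close> eventually inherits the bound
      \<open>\<alpha> - \<epsilon>\<close>.\<close>
    have ge: "\<alpha> \<le> \<psi> x" for x
    proof (rule tendsto_le[OF _ lim'])
      show "(\<lambda>n. \<alpha> - \<epsilon> (s n)) \<longlonglongrightarrow> \<alpha>"
        using tendsto_diff[OF tendsto_const filterlim_compose[OF e sub], of \<alpha>] by simp
      have "\<forall>\<^sub>F n in sequentially. D - x \<le> r (s n)"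
        using filterlim_compose[OF r sub] by (simp add: filterlim_at_top)
      then show "\<forall>\<^sub>F n in sequentially. \<alpha> - \<epsilon> (s n) \<le> u (s n) x"
      proof eventually_elim
        case (elim n)
        have "\<phi> (s n) (b (s n) - r (s n)) \<le> u (s n) x"
          unfolding u_def by (rule profileD(1)[OF P]) (use elim s0(2)[of "s1 n"] in \<open>simp add: s_def\<close>)
        then show ?case using br[of "s n"] by simp
      qed
    qed simp
    obtain l where l: "(\<psi> \<longlongrightarrow> l) at_bot" "\<And>x. l \<le> \<psi> x" "0 \<le> l" using profile_at_bot[OF P'] by blast
    have "f l \<le> 0" by (rule weak_super_limit[OF P' _ shift_to_bot[OF l(1)]]) (use K in blast)
    moreover have "\<alpha> \<le> l" by (rule tendsto_lowerbound[OF l(1)]) (use ge in auto)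
    moreover have "l \<le> p" using l(2)[of "-1"] K[THEN conjunct2, THEN conjunct1, rule_format, of "-1"] by simp
    ultimately have "l = \<alpha>" using fpos[of l] p by force
    then show ?thesis using l K P' unfolding p_def by blast
  qed
qed

end

section \<open>The linearisation at the intermediate state\<close>

context bistable begin

lemma integral_conv_fubini:
  fixes w :: "real \<Rightarrow> real"
  assumes [measurable]: "w \<in> borel_measurable borel" "S \<in> sets borel" and w: "\<And>x. 0 \<le> w x" "\<And>x. w x \<le> 1"
  shows "(\<lambda>s. \<integral>z. indicator S z * w (s - z) \<partial>\<mu>) integrable_on {x..y}"
    and "integrable \<mu> (\<lambda>z. indicator S z * integral {x..y} (\<lambda>s. w (s - z)))"
    and "integral {x..y} (\<lambda>s. \<integral>z. indicator S z * w (s - z) \<partial>\<mu>)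
      = (\<integral>z. indicator S z * integral {x..y} (\<lambda>s. w (s - z)) \<partial>\<mu>)"
proof -
  interpret Pr: pair_sigma_finite lborel \<mu> ..
  let ?g = "\<lambda>s. \<integral>z. indicator S z * w (s - z) \<partial>\<mu>"
  have "(\<lambda>(s, z). indicator S z * w (s - z)) \<in> borel_measurable (borel \<Otimes>\<^sub>M borel)" by measurable
  then have pm[measurable]: "(\<lambda>(s, z). indicator S z * w (s - z)) \<in> borel_measurable (borel \<Otimes>\<^sub>M \<mu>)"
    using measurable_cong_sets[OF sets_pair_measure_cong[OF refl sets_mu] refl] by blast
  then have gm: "?g \<in> borel_measurable borel" by (rule borel_measurable_lebesgue_integral)
  have int1: "integrable \<mu> (\<lambda>z. indicator S z * w (s - z))" for s
    by (rule integrable_const_bound[of _ 1]) (use w in \<open>auto simp: indicator_def\<close>)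
  have gb: "0 \<le> ?g s" "?g s \<le> 1" for s
  proof -
    show "0 \<le> ?g s" using w by (intro Bochner_Integration.integral_nonneg) (auto simp: indicator_def)
    have "?g s \<le> (\<integral>z. 1 \<partial>\<mu>)" using w by (intro integral_mono int1) (auto simp: indicator_def)
    then show "?g s \<le> 1" using prob_space by simp
  qed
  show "?g integrable_on {x..y}"
    by (rule bounded_measurable_integrable_on[OF gm, of 1]) (use gb in \<open>auto simp: abs_le_iff intro: order_trans\<close>)
  let ?F = "\<lambda>s z. indicator {x..y} s * (indicator S z * w (s - z))"
  have intF: "integrable (lborel \<Otimes>\<^sub>M \<mu>) (case_prod ?F)"
  proof (rule integrableI_bounded_set[where A="{x..y} \<times> UNIV" and B=1])
    have "emeasure (lborel \<Otimes>\<^sub>M \<mu>) ({x..y} \<times> UNIV) = emeasure lborel {x..y} * emeasure \<mu> UNIV"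
      by (rule emeasure_pair_measure_Times) (auto simp: sets_mu)
    also have "\<dots> < \<infinity>" by (auto simp: emeasure_lborel_Icc_eq emeasure_eq_measure ennreal_mult_less_top)
    finally show "emeasure (lborel \<Otimes>\<^sub>M \<mu>) ({x..y} \<times> UNIV) < \<infinity>" .
    show "AE p in lborel \<Otimes>\<^sub>M \<mu>. p \<in> {x..y} \<times> UNIV \<longrightarrow> norm (case_prod ?F p) \<le> 1"
      using w by (auto simp: indicator_def)
  qed (auto simp: indicator_def)
  have set_int: "integral {x..y} h = (\<integral>s. indicator {x..y} s * h s \<partial>lborel)"
    if "h \<in> borel_measurable borel" "\<And>s. 0 \<le> h s" "\<And>s. h s \<le> 1" for h :: "real \<Rightarrow> real"
  proof -
    have "set_integrable lborel {x..y} h"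
      unfolding set_integrable_def
      by (rule integrableI_bounded_set_indicator[where B=1]) (use that in \<open>auto simp: emeasure_lborel_Icc_eq\<close>)
    from set_borel_integral_eq_integral(2)[OF this] show ?thesis
      by (simp add: set_lebesgue_integral_def)
  qed
  have inner: "(\<integral>s. ?F s z \<partial>lborel) = indicator S z * integral {x..y} (\<lambda>s. w (s - z))" for z
  proof -
    have "(\<integral>s. ?F s z \<partial>lborel) = (\<integral>s. indicator S z * (indicator {x..y} s * w (s - z)) \<partial>lborel)"
      by (simp add: mult.left_commute)
    also have "\<dots> = indicator S z * (\<integral>s. indicator {x..y} s * w (s - z) \<partial>lborel)" by simp
    also have "(\<integral>s. indicator {x..y} s * w (s - z) \<partial>lborel) = integral {x..y} (\<lambda>s. w (s - z))"
      by (rule set_int[symmetric]) (use w in auto)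
    finally show ?thesis .
  qed
  show "integrable \<mu> (\<lambda>z. indicator S z * integral {x..y} (\<lambda>s. w (s - z)))"
    using Pr.integrable_snd[OF intF] unfolding inner .
  have "integral {x..y} ?g = (\<integral>s. indicator {x..y} s * ?g s \<partial>lborel)" by (rule set_int[OF gm gb])
  also have "\<dots> = (\<integral>s. (\<integral>z. ?F s z \<partial>\<mu>) \<partial>lborel)" by simp
  also have "\<dots> = (\<integral>z. (\<integral>s. ?F s z \<partial>lborel) \<partial>\<mu>)" by (rule Pr.Fubini_integral[OF intF, symmetric])
  finally show "integral {x..y} ?g = (\<integral>z. indicator S z * integral {x..y} (\<lambda>s. w (s - z)) \<partial>\<mu>)"
    unfolding inner .
qed

text \<open>The mean is truncated because \<open>\<mu>\<close> may have no first moment.\<close>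

definition drift :: "real \<Rightarrow> real" where
  "drift A = (\<integral>z. indicator {z. \<bar>z\<bar> \<le> A} z * z \<partial>\<mu>)"

lemma drift_integrable: "integrable \<mu> (\<lambda>z. indicator {z. \<bar>z\<bar> \<le> A} z * z)"
  by (rule integrable_const_bound[of _ "\<bar>A\<bar>"]) (auto simp: indicator_def)

lemma drift_flip: "bistable.drift \<mu>' A = - drift A"
proof -
  interpret F: bistable \<mu>' f' "1 - \<alpha>" L \<kappa> \<delta> by (rule bistable_flip)
  have "F.drift A = (\<integral>z. - (indicator {z. \<bar>z\<bar> \<le> A} z * z) \<partial>\<mu>)"
    unfolding F.drift_def by (subst integral_distr) (auto simp: indicator_def intro!: Bochner_Integration.integral_cong)
  then show ?thesis unfolding drift_def by simp
qed

text \<open>Integrating the linearised inequality at \<open>\<alpha>\<close>: for monotone \<open>v = \<phi> - \<alpha>\<close> translation by \<open>z\<close> changes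
  \<open>\<integral> v\<close> by at least \<open>- z v(x)\<close> up to boundary terms vanishing at \<open>-\<infinity>\<close>, so only the truncated mean of \<open>\<mu>\<close> enters.\<close>

lemma shifted_integral_ge:
  assumes P: "profile \<phi>" and yx: "y \<le> x" and z: "\<bar>z\<bar> \<le> A" and ge: "\<And>x. \<alpha> \<le> \<phi> x"
  shows "integral {y..x} \<phi> - z * (\<phi> x - \<alpha>) - A * (\<phi> (y + A) - \<alpha>) \<le> integral {y..x} (\<lambda>s. \<phi> (s - z))"
proof (cases "0 \<le> z")
  case True
  have "integral {y..x} (\<lambda>s. \<phi> s - \<phi> (s - z)) = integral {x - z..x} \<phi> - integral {y - z..y} \<phi>"
    by (rule integral_backward_difference[OF P True yx])
  moreover have "integral {y..x} (\<lambda>s. \<phi> s - \<phi> (s - z)) = integral {y..x} \<phi> - integral {y..x} (\<lambda>s. \<phi> (s - z))"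
    using profile_integrable_on[OF P] profile_integrable_on[OF profile_shift[OF P, of "- z"]] by (subst integral_diff) auto
  moreover have "integral {x - z..x} \<phi> \<le> (x - (x - z)) * \<phi> x"
    by (rule profile_integral_le[OF P]) (use True profileD(1)[OF P] in auto)
  moreover have "(y - (y - z)) * \<alpha> \<le> integral {y - z..y} \<phi>"
    by (rule profile_integral_ge[OF P]) (use True ge in auto)
  moreover have "0 \<le> A * (\<phi> (y + A) - \<alpha>)" using ge z by auto
  ultimately show ?thesis by (simp add: algebra_simps)
next
  case False
  have "(- z) * (\<phi> x - \<phi> (y + - z)) \<le> integral {y..x} (\<lambda>s. \<phi> (s + - z) - \<phi> s)"
    by (rule integral_forward_difference_ge[OF P _ yx]) (use False in auto)
  also have "\<dots> = integral {y..x} (\<lambda>s. \<phi> (s - z)) - integral {y..x} \<phi>"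
    using profile_integrable_on[OF P] profile_integrable_on[OF profile_shift[OF P, of "- z"]] by (subst integral_diff) auto
  finally have 1: "(- z) * (\<phi> x - \<phi> (y - z)) \<le> integral {y..x} (\<lambda>s. \<phi> (s - z)) - integral {y..x} \<phi>" by simp
  have "(- z) * (\<phi> (y - z) - \<alpha>) \<le> A * (\<phi> (y + A) - \<alpha>)"
    by (rule mult_mono) (use False z ge profileD(1)[OF P, of "y - z" "y + A"] in auto)
  then show ?thesis using 1 by (simp add: algebra_simps)
qed

text \<open>On the interval instability gives \<open>f (\<phi> s) \<ge> \<kappa> * v s\<close>.
  Discarding jumps longer than \<open>A\<close> loses at most the fraction
  \<open>\<kappa> / 2\<close> of the mass, so half of the growth rate survives. Fubini reduces the
  remaining convolution to integrals of translates of \<open>v\<close>.\<close>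

lemma linear_estimate:
  assumes P: "profile \<phi>" and W: "weak_super \<mu> f c \<phi>" and ge: "\<And>x. \<alpha> \<le> \<phi> x"
    and A: "0 \<le> A" "prob {z. A < \<bar>z\<bar>} \<le> \<kappa> / 2"
    and yx: "y < x" and small: "\<phi> x \<le> \<alpha> + \<delta>"
  shows "\<kappa> / 2 * (integral {y..x} \<phi> - (x - y) * \<alpha>) + c * (\<phi> y - \<alpha>) - A * (\<phi> (y + A) - \<alpha>)
    \<le> (c + drift A) * (\<phi> x - \<alpha>)"
proof -
  let ?S = "{z. \<bar>z\<bar> \<le> A}"
  define v where "v s = \<phi> s - \<alpha>" for s
  define I where "I = integral {y..x} v"
  note [measurable] = profile_measurable[OF P]
  have v: "0 \<le> v s" "v s \<le> 1" for s using ge[of s] profileD(3)[OF P, of s] al by (auto simp: v_def)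
  have vm[measurable]: "v \<in> borel_measurable borel" unfolding v_def[abs_def] by measurable
  have vi: "v integrable_on {y..x}" by (rule bounded_measurable_integrable_on[OF vm, of 1]) (use v in \<open>auto simp: abs_le_iff intro: order_trans[of _ 0]\<close>)
  have I: "I = integral {y..x} \<phi> - (x - y) * \<alpha>"
    unfolding I_def v_def[abs_def] using yx by (subst integral_diff) (auto simp: profile_integrable_on[OF P])
  note vk = integrable_on_cmult_left[OF vi, of "\<kappa> - 1"]
  have I0: "0 \<le> I" unfolding I_def by (rule integral_nonneg[OF vi]) (use v in auto)
  have [measurable]: "?S \<in> sets borel" by measurable
  note fub = integral_conv_fubini[of v ?S, OF vm _ v]
  have Sm: "?S \<in> sets borel" by measurable
  let ?g = "\<lambda>s. \<integral>z. indicator ?S z * v (s - z) \<partial>\<mu>"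
  have rhs_ge: "?g s + (\<kappa> - 1) * v s \<le> R \<phi> s" if "s \<in> {y..x}" for s
  proof -
    have "v s \<le> \<delta>" using small profileD(1)[OF P, of s x] that by (auto simp: v_def)
    then have "\<kappa> * (v s)\<^sup>2 \<le> f (\<phi> s) * v s" using unstable[of "\<phi> s"] v[of s] by (auto simp: v_def)
    then have f: "\<kappa> * v s \<le> f (\<phi> s)"
      using v(1)[of s] by (cases "v s = 0") (auto simp: power2_eq_square v_def mult.assoc[symmetric] mult_le_cancel_right)
    have "?g s \<le> (\<integral>z. \<phi> (s - z) - \<alpha> \<partial>\<mu>)"
    proof (rule integral_mono)
      show "integrable \<mu> (\<lambda>z. indicator ?S z * v (s - z))"
        by (rule integrable_const_bound[of _ 1]) (use v in \<open>auto simp: indicator_def\<close>)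
      show "indicator ?S z * v (s - z) \<le> \<phi> (s - z) - \<alpha>" for z
        using v(1)[of "s - z"] by (auto simp: v_def indicator_def)
    qed (use profile_integrable[OF P] in auto)
    also have "\<dots> = conv \<mu> \<phi> s - \<alpha>"
      unfolding conv_def using prob_space by (subst Bochner_Integration.integral_diff) (auto simp: profile_integrable[OF P])
    finally show ?thesis using f by (simp add: rhs_def v_def algebra_simps)
  qed
  have "integral {y..x} ?g + (\<kappa> - 1) * I = integral {y..x} (\<lambda>s. ?g s + (\<kappa> - 1) * v s)"
    unfolding I_def using fub(1)[OF Sm] vi vk by (subst integral_add) auto
  also have "\<dots> \<le> integral {y..x} (R \<phi>)"
    using fub(1)[OF Sm] vk by (intro integral_le rhs_integrable_on[OF P] rhs_ge integrable_add) auto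
  also have "\<dots> \<le> c * (\<phi> x - \<phi> y)" using W yx by (simp add: weak_super_def)
  finally have 1: "integral {y..x} ?g + (\<kappa> - 1) * I \<le> c * (v x - v y)" by (simp add: v_def)
  have "prob ?S * I - drift A * v x - prob ?S * (A * v (y + A))
      = (\<integral>z. indicator ?S z * I - indicator ?S z * z * v x - indicator ?S z * (A * v (y + A)) \<partial>\<mu>)"
    using drift_integrable[of A] Sm
    by (subst Bochner_Integration.integral_diff, (auto intro!: integrable_real_indicator simp: sets_mu emeasure_eq_measure)[2])
      (subst Bochner_Integration.integral_diff, auto intro!: integrable_real_indicator simp: sets_mu emeasure_eq_measure drift_def)
  also have "\<dots> \<le> (\<integral>z. indicator ?S z * integral {y..x} (\<lambda>s. v (s - z)) \<partial>\<mu>)"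
  proof (rule integral_mono[OF _ fub(2)[OF Sm]])
    show "integrable \<mu> (\<lambda>z. indicator ?S z * I - indicator ?S z * z * v x - indicator ?S z * (A * v (y + A)))"
      using drift_integrable[of A] Sm by (auto intro!: integrable_real_indicator simp: sets_mu emeasure_eq_measure)
    fix z
    show "indicator ?S z * I - indicator ?S z * z * v x - indicator ?S z * (A * v (y + A))
        \<le> indicator ?S z * integral {y..x} (\<lambda>s. v (s - z))"
    proof (cases "z \<in> ?S")
      case True
      have "integral {y..x} (\<lambda>s. v (s - z)) = integral {y..x} (\<lambda>s. \<phi> (s - z)) - (x - y) * \<alpha>"
        unfolding v_def using yx profile_integrable_on[OF profile_shift[OF P, of "- z"]]
        by (subst integral_diff) auto
      then show ?thesis
        using True shifted_integral_ge[OF P _ _ ge, of y x z A] yx by (simp add: I v_def)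
    qed simp
  qed
  also have "\<dots> = integral {y..x} ?g" by (rule fub(3)[OF Sm, symmetric])
  finally have 2: "prob ?S * I - drift A * v x - prob ?S * (A * v (y + A)) \<le> integral {y..x} ?g" .
  have "prob ?S = 1 - prob {z. A < \<bar>z\<bar>}"
    using prob_compl[of "{z. A < \<bar>z\<bar>}"] by (auto simp: sets_mu Compl_eq_Diff_UNIV[symmetric] not_less Collect_neg_eq[symmetric])
  then have "(1 - \<kappa> / 2) * I \<le> prob ?S * I" using A(2) I0 by (intro mult_right_mono) auto
  moreover have "prob ?S * (A * v (y + A)) \<le> A * v (y + A)"
    using A v by (intro mult_left_le_one_le) auto
  ultimately have "\<kappa> / 2 * I + c * v y - A * v (y + A) \<le> (c + drift A) * v x"
    using 1 2 by (simp add: algebra_simps)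
  then show ?thesis by (simp add: I v_def)
qed

text \<open>If \<open>\<phi>\<close> exceeds \<open>\<alpha>\<close> somewhere left of
  \<open>x1\<close>, the linear estimate makes \<open>c + drift A\<close> strictly positive.
  Otherwise \<open>\<phi>\<close> equals \<open>\<alpha>\<close> on a left half-line; there the
  convolution must also equal \<open>\<alpha>\<close>, so \<open>\<mu>\<close> charges no negative
  jumps, and \<open>drift A\<close> and \<open>c\<close> are both nonnegative.\<close>

lemma right_piece_drift:
  assumes P: "profile \<phi>" and W: "weak_super \<mu> f c \<phi>" and bot: "(\<phi> \<longlongrightarrow> \<alpha>) at_bot"
    and right: "\<And>x. 0 < x \<Longrightarrow> (1 + \<alpha>) / 2 \<le> \<phi> x"
    and A: "0 \<le> A" "prob {z. A < \<bar>z\<bar>} \<le> \<kappa> / 2"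
  shows "0 \<le> c + drift A" and "c + drift A = 0 \<Longrightarrow> prob {z. z < 0} = 0"
proof -
  have ge: "\<alpha> \<le> \<phi> x" for x
    using profile_at_bot[OF P] tendsto_unique[OF _ bot] by (metis trivial_limit_at_bot_linorder)
  have "\<forall>\<^sub>F x in at_bot. \<phi> x < \<alpha> + \<delta>" by (rule order_tendstoD(2)[OF bot]) (use kd in simp)
  then obtain x1 where x1: "\<phi> x1 < \<alpha> + \<delta>" by (auto simp: eventually_at_bot_linorder)
  \<comment> \<open>The lower endpoint of the estimate is sent to -\<infinity>, which removes its
    boundary terms; of the integral only the part over \<open>{y..x1}\<close> is kept.\<close>
  have main: "\<kappa> / 2 * ((x1 - y) * (\<phi> y - \<alpha>)) \<le> (c + drift A) * (\<phi> x1 - \<alpha>)" if y: "y < x1" for y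
  proof (rule LIMSEQ_le_const2)
    have "(\<lambda>n. \<kappa> / 2 * ((x1 - y) * (\<phi> y - \<alpha>)) + c * (\<phi> (y + - real n) - \<alpha>) - A * (\<phi> (y + A + - real n) - \<alpha>))
       \<longlonglongrightarrow> \<kappa> / 2 * ((x1 - y) * (\<phi> y - \<alpha>)) + c * (\<alpha> - \<alpha>) - A * (\<alpha> - \<alpha>)"
      by (intro tendsto_intros shift_to_bot[OF bot])
    then show "(\<lambda>n. \<kappa> / 2 * ((x1 - y) * (\<phi> y - \<alpha>)) + c * (\<phi> (y + - real n) - \<alpha>) - A * (\<phi> (y + A + - real n) - \<alpha>))
       \<longlonglongrightarrow> \<kappa> / 2 * ((x1 - y) * (\<phi> y - \<alpha>))" by simp
    show "\<exists>N. \<forall>n\<ge>N. \<kappa> / 2 * ((x1 - y) * (\<phi> y - \<alpha>)) + c * (\<phi> (y + - real n) - \<alpha>) - A * (\<phi> (y + A + - real n) - \<alpha>)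
        \<le> (c + drift A) * (\<phi> x1 - \<alpha>)"
    proof (intro exI allI impI)
      fix n :: nat
      let ?y = "y + - real n"
      have "integral {?y..x1} \<phi> = integral {?y..y} \<phi> + integral {y..x1} \<phi>"
        by (rule Henstock_Kurzweil_Integration.integral_combine[symmetric]) (use y profile_integrable_on[OF P] in auto)
      moreover have "(y - ?y) * \<alpha> \<le> integral {?y..y} \<phi>"
        by (rule profile_integral_ge[OF P]) (use ge in auto)
      moreover have "(x1 - y) * \<phi> y \<le> integral {y..x1} \<phi>"
        by (rule profile_integral_ge[OF P]) (use y profileD(1)[OF P] in auto)
      ultimately have "(x1 - y) * (\<phi> y - \<alpha>) \<le> integral {?y..x1} \<phi> - (x1 - ?y) * \<alpha>"
        by (simp add: algebra_simps)
      then have "\<kappa> / 2 * ((x1 - y) * (\<phi> y - \<alpha>)) \<le> \<kappa> / 2 * (integral {?y..x1} \<phi> - (x1 - ?y) * \<alpha>)"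
        using kd by (intro mult_left_mono) auto
      moreover have "\<kappa> / 2 * (integral {?y..x1} \<phi> - (x1 - ?y) * \<alpha>) + c * (\<phi> ?y - \<alpha>) - A * (\<phi> (?y + A) - \<alpha>)
          \<le> (c + drift A) * (\<phi> x1 - \<alpha>)"
        by (rule linear_estimate[OF P W ge A]) (use y x1 in auto)
      moreover have "?y + A = y + A + - real n" by simp
      ultimately show "\<kappa> / 2 * ((x1 - y) * (\<phi> y - \<alpha>)) + c * (\<phi> ?y - \<alpha>) - A * (\<phi> (y + A + - real n) - \<alpha>)
        \<le> (c + drift A) * (\<phi> x1 - \<alpha>)" by (simp only:)
    qed
  qed
  have "0 < c + drift A \<or> (0 \<le> c + drift A \<and> prob {z. z < 0} = 0)"
  proof (cases "\<exists>y<x1. \<alpha> < \<phi> y")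
    case True
    then obtain y where y: "y < x1" "\<alpha> < \<phi> y" by blast
    have "0 < \<kappa> / 2 * ((x1 - y) * (\<phi> y - \<alpha>))" using y kd by simp
    also have "\<dots> \<le> (c + drift A) * (\<phi> x1 - \<alpha>)" by (rule main[OF y(1)])
    finally show ?thesis using ge[of x1] by (simp add: zero_less_mult_iff)
  next
    case False
    let ?Z = "{x. \<phi> x \<le> \<alpha>}"
    define \<xi> where "\<xi> = Sup ?Z"
    have ne: "x1 - 1 \<in> ?Z" using False[unfolded not_ex, THEN spec, of "x1 - 1"] by auto
    have bdd: "bdd_above ?Z"
    proof (rule bdd_aboveI[of _ 0])
      fix x assume "x \<in> ?Z"
      then show "x \<le> 0" using right[of x] al by (cases "x \<le> 0") (auto simp: field_simps)
    qed
    have lt: "\<phi> x = \<alpha>" if x: "x < \<xi>" for x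
    proof -
      obtain x' where "x' \<in> ?Z" "x < x'" using less_cSupE[of x ?Z] x ne unfolding \<xi>_def by blast
      then show ?thesis using profileD(1)[OF P, of x x'] ge[of x] by auto
    qed
    have gt: "\<alpha> < \<phi> x" if "\<xi> < x" for x
      using cSup_upper[OF _ bdd, of x] that unfolding \<xi>_def by (cases "\<phi> x \<le> \<alpha>") auto
    have cge: "\<alpha> \<le> conv \<mu> \<phi> x" for x
      using conv_le[OF profile_const P, of \<alpha> x x] ge al by simp
    have cint: "integrable \<mu> (\<lambda>z. \<phi> (x - z) - \<alpha>)" for x using profile_integrable[OF P] by auto
    \<comment> \<open>Left of \<open>\<xi>\<close> the profile is flat, so the integral of
      \<open>conv \<mu> \<phi> - \<alpha>\<close> is at most 0. Its integrand is nonnegative and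
      monotone, hence vanishes at \<open>x\<close>; but jumps \<open>z < x - \<xi>\<close> reach
      values above \<open>\<alpha>\<close>.\<close>
    have null: "prob {z. z < x - \<xi>} = 0" if x: "x < \<xi>" for x
    proof -
      obtain y where y: "x < y" "y < \<xi>" using dense[OF x] by blast
      have "(y - x) * conv \<mu> \<phi> x \<le> integral {x..y} (conv \<mu> \<phi>)"
        by (rule profile_integral_ge[OF conv_profile[OF P]]) (use y profileD(1)[OF conv_profile[OF P]] in auto)
      moreover have "integral {x..y} (conv \<mu> \<phi>) - (y - x) * \<alpha> = integral {x..y} (\<lambda>s. conv \<mu> \<phi> s - \<alpha>)"
        using y by (subst integral_diff) (auto intro: profile_integrable_on[OF conv_profile[OF P]])
      moreover have "integral {x..y} (\<lambda>s. conv \<mu> \<phi> s - \<alpha>) = integral {x..y} (R \<phi>)"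
        by (rule integral_cong) (use lt y in \<open>auto simp: rhs_def\<close>)
      moreover have "integral {x..y} (R \<phi>) \<le> c * (\<phi> y - \<phi> x)" using W y by (simp add: weak_super_def)
      ultimately have "(y - x) * (conv \<mu> \<phi> x - \<alpha>) \<le> 0" using lt[of x] lt[of y] y by (simp add: algebra_simps)
      then have "conv \<mu> \<phi> x \<le> \<alpha>" using y by (auto simp: mult_le_0_iff)
      then have "(\<integral>z. \<phi> (x - z) - \<alpha> \<partial>\<mu>) = 0"
        using cge[of x] prob_space profile_integrable[OF P] unfolding conv_def
        by (subst Bochner_Integration.integral_diff) auto
      then have "AE z in \<mu>. \<phi> (x - z) - \<alpha> = 0"
        using integral_nonneg_eq_0_iff_AE[OF cint] ge by simp
      then have "AE z in \<mu>. z \<notin> {z. z < x - \<xi>}"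
        by eventually_elim (use gt in force)
      then show ?thesis by (subst prob_eq_0) (auto simp: sets_mu)
    qed
    have "AE z in \<mu>. \<forall>n::nat. \<not> z < - (1 / real (Suc n))"
    proof (subst AE_all_countable, rule allI)
      fix n :: nat
      have "prob {z. z < - (1 / real (Suc n))} = 0" using null[of "\<xi> - 1 / real (Suc n)"] by simp
      then show "AE z in \<mu>. \<not> z < - (1 / real (Suc n))" by (subst (asm) prob_eq_0) (auto simp: sets_mu)
    qed
    then have pos: "AE z in \<mu>. 0 \<le> z"
    proof eventually_elim
      case (elim z)
      show ?case
      proof (rule ccontr)
        assume "\<not> 0 \<le> z"
        then obtain n where "inverse (real (Suc n)) < - z" using reals_Archimedean[of "- z"] by auto
        then show False using elim[rule_format, of n] by (simp add: inverse_eq_divide)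
      qed
    qed
    have p0: "prob {z. z < 0} = 0"
      by (subst prob_eq_0) (use pos in \<open>auto simp: sets_mu elim!: eventually_mono\<close>)
    have "0 \<le> drift A"
      unfolding drift_def by (rule integral_nonneg_AE) (use pos in \<open>auto simp: indicator_def elim!: eventually_mono\<close>)
    moreover have "0 \<le> c"
    proof (rule ccontr)
      assume c: "\<not> 0 \<le> c"
      \<comment> \<open>On the window from \<open>\<xi> - d\<close> to \<open>\<xi> + d\<close> the
        function \<open>R \<phi>\<close> is at least \<open>- (1 + L)\<close> times the rise of
        \<open>\<phi>\<close>. Integration gives \<open>- c \<le> 2 * d * (1 + L)\<close>, and this
        \<open>d\<close> makes the right side equal to \<open>- c / 2\<close>.\<close>
      define d where "d = - c / (4 * (1 + L))"
      have d: "0 < d" "4 * (1 + L) * d = - c" using c L0 by (auto simp: d_def divide_neg_pos)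
      define y where "y = \<xi> + d"
      have vy: "0 < \<phi> y - \<alpha>" using gt[of y] d by (simp add: y_def)
      have "- (1 + L) * (\<phi> y - \<alpha>) \<le> R \<phi> s" if s: "s \<le> y" for s
      proof -
        have "f (\<phi> s) \<ge> - (L * (\<phi> s - \<alpha>))" using lip[of "\<phi> s" \<alpha>] ge[of s] by (simp add: abs_le_iff)
        then have "- (1 + L) * (\<phi> s - \<alpha>) \<le> R \<phi> s" using cge[of s] by (simp add: rhs_def algebra_simps)
        moreover have "(1 + L) * (\<phi> s - \<alpha>) \<le> (1 + L) * (\<phi> y - \<alpha>)"
          using L0 profileD(1)[OF P s] by (intro mult_left_mono) auto
        ultimately show ?thesis unfolding minus_mult_left[symmetric] by linarith
      qed
      moreover have const: "integral {\<xi> - d..y} (\<lambda>_. C) = 2 * d * C" for C :: real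
        using d by (simp add: y_def)
      ultimately have "integral {\<xi> - d..y} (\<lambda>_. - (1 + L) * (\<phi> y - \<alpha>)) \<le> integral {\<xi> - d..y} (R \<phi>)"
        by (intro integral_le rhs_integrable_on[OF P]) auto
      also have "\<dots> \<le> c * (\<phi> y - \<phi> (\<xi> - d))" using W d by (simp add: weak_super_def y_def)
      also have "\<phi> (\<xi> - d) = \<alpha>" using lt d by simp
      finally have "2 * d * (- (1 + L) * (\<phi> y - \<alpha>)) \<le> c * (\<phi> y - \<alpha>)" by (simp only: const)
      then have "(- c) * (\<phi> y - \<alpha>) \<le> (2 * d * (1 + L)) * (\<phi> y - \<alpha>)" by (simp add: algebra_simps)
      then have "- c \<le> 2 * d * (1 + L)" using vy mult_le_cancel_right[of "- c" "\<phi> y - \<alpha>"] by (simp del: mult_minus_left)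
      then show False using d c by (simp add: algebra_simps)
    qed
    ultimately show ?thesis using p0 by auto
  qed
  then show "0 \<le> c + drift A" "c + drift A = 0 \<Longrightarrow> prob {z. z < 0} = 0" by auto
qed

section \<open>Existence of a wave\<close>

lemma wave_if_dirac:
  assumes "prob {z. z < 0} = 0" "prob {z. 0 < z} = 0"
  shows "\<exists>c \<phi>. wave c \<phi>"
proof -
  have "AE z in \<mu>. z \<notin> {z. z < 0}" "AE z in \<mu>. z \<notin> {z. 0 < z}"
    using assms prob_eq_0[of "{z. z < 0}"] prob_eq_0[of "{z. 0 < z}"] by (auto simp: sets_mu)
  then have z0: "AE z in \<mu>. z = 0" by eventually_elim auto
  define \<phi> where "\<phi> x = (if x < 0 then 0 else 1 :: real)" for x :: real
  have P: "profile \<phi>" by (rule profileI) (auto simp: \<phi>_def)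
  have "conv \<mu> \<phi> x = \<phi> x" for x
  proof -
    note [measurable] = profile_measurable[OF P]
    have "conv \<mu> \<phi> x = (\<integral>z. \<phi> x \<partial>\<mu>)"
      unfolding conv_def by (rule integral_cong_AE) (use z0 in \<open>auto elim!: eventually_mono\<close>)
    then show ?thesis using prob_space by simp
  qed
  then have R0: "R \<phi> x = 0" for x by (simp add: rhs_def \<phi>_def)
  have "\<forall>\<^sub>F x in at_bot. \<phi> x = 0" unfolding eventually_at_bot_linorder by (auto simp: \<phi>_def intro!: exI[of _ "-1"])
  moreover have "\<forall>\<^sub>F x in at_top. \<phi> x = 1" unfolding eventually_at_top_linorder by (auto simp: \<phi>_def intro!: exI[of _ 0])
  ultimately have "wave 0 \<phi>"
    unfolding wave_def weak_super_def rhs_flip[OF P, abs_def] R0[abs_def]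
    using P R0 by (auto intro: tendsto_eventually)
  then show ?thesis by blast
qed

text \<open>Speed bounds for the fronts and their reflections give one convergent subsequence of
  speeds. Both limiting pieces are taken along it, so their drift inequalities concern the same
  \<open>c\<close>.\<close>

lemma wave_exists: "\<exists>c \<phi>. wave c \<phi>"
proof -
  interpret F: bistable \<mu>' f' "1 - \<alpha>" L \<kappa> \<delta> by (rule bistable_flip)
  obtain C r0 where C: "\<And>h r \<epsilon> k a b \<phi>. 0 < h \<Longrightarrow> h \<le> 1 \<Longrightarrow> r0 \<le> r \<Longrightarrow> \<epsilon> \<le> \<alpha> / 4 \<Longrightarrow> approx_front h r \<epsilon> k a b \<phi> \<Longrightarrow> k * h \<le> C"
    by (rule speed_bound) blast
  obtain C' r0' where C': "\<And>h r \<epsilon> k a b \<phi>. 0 < h \<Longrightarrow> h \<le> 1 \<Longrightarrow> r0' \<le> r \<Longrightarrow> \<epsilon> \<le> (1 - \<alpha>) / 4 \<Longrightarrow> F.approx_front h r \<epsilon> k a b \<phi> \<Longrightarrow> k * h \<le> C'"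
    by (rule F.speed_bound) blast
  \<comment> \<open>The index shift makes every \<open>r n\<close> exceed all thresholds of the two
    speed bounds. The reciprocal \<open>h n\<close> then serves both as mesh and as
    \<open>\<epsilon>\<close>.\<close>
  obtain n0 :: nat where n0: "max (max r0 r0') (max (4 / \<alpha>) (4 / (1 - \<alpha>))) \<le> real n0" using real_arch_simple by blast
  define r where "r n = real (Suc (n + n0))" for n
  define h where "h n = 1 / r n" for n
  have rp: "0 < r n" "1 \<le> r n" "r0 \<le> r n" "r0' \<le> r n" "4 / \<alpha> \<le> r n" "4 / (1 - \<alpha>) \<le> r n" for n
    using n0 by (auto simp: r_def)
  have hp: "0 < h n" "h n \<le> 1" "h n \<le> \<alpha> / 4" "h n \<le> (1 - \<alpha>) / 4" for n
    using rp[of n] al by (auto simp: h_def field_simps)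
  have rtop: "filterlim r at_top sequentially"
    unfolding r_def using filterlim_compose[OF filterlim_real_sequentially, of "\<lambda>n. Suc (n + n0)"]
      filterlim_subseq[of "\<lambda>n. Suc (n + n0)"] by (simp add: strict_mono_def)
  have hlim: "h \<longlonglongrightarrow> 0"
    unfolding h_def[abs_def] using tendsto_inverse_0_at_top[OF rtop] by (simp add: inverse_eq_divide)
  have "\<forall>n. \<exists>k a b \<phi>. approx_front (h n) (r n) (h n) k a b \<phi>"
    using approx_front_exists hp(1) rp(1) by blast
  then obtain k a b \<phi> where ap: "\<And>n. approx_front (h n) (r n) (h n) (k n) (a n) (b n) (\<phi> n)" by metis
  have up: "k n * h n \<le> C" for n by (rule C[OF _ _ _ _ ap]) (use hp rp in auto)
  have "- k n * h n \<le> C'" for n by (rule C'[OF _ _ _ _ approx_front_flip[OF ap]]) (use hp rp in auto)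
  then have "norm (k n * h n) \<le> max C C'" for n using up[of n] by (auto simp: abs_le_iff max_def) (smt (verit))+
  then have "bounded (range (\<lambda>n. k n * h n))" by (auto simp: bounded_iff)
  then obtain c s where s: "strict_mono s" and c: "(\<lambda>n. k (s n) * h (s n)) \<longlonglongrightarrow> c"
    using bounded_imp_convergent_subsequence[of "\<lambda>n. k n * h n"] by (auto simp: o_def)
  have sub: "filterlim s sequentially sequentially" by (rule filterlim_subseq[OF s])
  have hs: "(\<lambda>n. h (s n)) \<longlonglongrightarrow> 0" by (rule filterlim_compose[OF hlim sub])
  have rs: "filterlim (\<lambda>n. r (s n)) at_top sequentially" by (rule filterlim_compose[OF rtop sub])
  have c': "(\<lambda>n. - k (s n) * h (s n)) \<longlonglongrightarrow> - c" using tendsto_minus[OF c] by simp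
  have 1: "(\<exists>\<psi>. wave c \<psi>) \<or> (\<exists>\<psi>. profile \<psi> \<and> weak_super \<mu> f c \<psi> \<and> (\<psi> \<longlongrightarrow> \<alpha>) at_bot \<and> (\<forall>x>0. (1 + \<alpha>) / 2 \<le> \<psi> x))"
    by (rule right_piece[OF ap hp(1) hs rs hs c])
  have 2: "(\<exists>\<psi>. F.wave (- c) \<psi>) \<or> (\<exists>\<psi>. profile \<psi> \<and> weak_super \<mu>' f' (- c) \<psi> \<and> (\<psi> \<longlongrightarrow> 1 - \<alpha>) at_bot
      \<and> (\<forall>x>0. (1 + (1 - \<alpha>)) / 2 \<le> \<psi> x))"
    by (rule F.right_piece[OF approx_front_flip[OF ap] hp(1) hs rs hs c'])
  show ?thesis
  proof (cases "(\<exists>\<psi>. wave c \<psi>) \<or> (\<exists>\<psi>. F.wave (- c) \<psi>)")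
    case True
    then show ?thesis using wave_of_flip by blast
  next
    case False
    then obtain \<psi> \<psi>' where \<psi>: "profile \<psi>" "weak_super \<mu> f c \<psi>" "(\<psi> \<longlongrightarrow> \<alpha>) at_bot" "\<And>x. 0 < x \<Longrightarrow> (1 + \<alpha>) / 2 \<le> \<psi> x"
      and \<psi>': "profile \<psi>'" "weak_super \<mu>' f' (- c) \<psi>'" "(\<psi>' \<longlongrightarrow> 1 - \<alpha>) at_bot" "\<And>x. 0 < x \<Longrightarrow> (1 + (1 - \<alpha>)) / 2 \<le> \<psi>' x"
      using 1 2 by blast
    obtain A where A: "0 < A" "prob {z. A < \<bar>z\<bar>} < \<kappa> / 2" using tail_prob_small[of "\<kappa> / 2"] kd by auto
    have flip_prob: "F.prob {z. P z} = prob {z. P (- z)}" if "{z. P z} \<in> sets borel" for P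
      using that by (subst measure_distr) (auto simp: vimage_def)
    have A': "F.prob {z. A < \<bar>z\<bar>} \<le> \<kappa> / 2" using A by (subst flip_prob) auto
    have d: "0 \<le> c + drift A" "c + drift A = 0 \<Longrightarrow> prob {z. z < 0} = 0"
      using right_piece_drift[OF \<psi>, of A] A by auto
    have d': "0 \<le> - c + F.drift A" "- c + F.drift A = 0 \<Longrightarrow> F.prob {z. z < 0} = 0"
      using F.right_piece_drift[OF \<psi>', of A] A A' by auto
    \<comment> \<open>Reflection negates the drift, so the two inequalities are opposite; equality
      leaves no mass on either side of 0.\<close>
    have "c + drift A = 0" using d(1) d'(1) unfolding drift_flip by simp
    then have "prob {z. z < 0} = 0" "F.prob {z. z < 0} = 0" using d(2) d'(2) unfolding drift_flip by auto
    then show ?thesis using wave_if_dirac by (subst (asm) flip_prob) auto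
  qed
qed

end

section \<open>From weak profiles to solutions\<close>

context bistable begin

lemma wave_weak_equation:
  assumes w: "wave c \<phi>" and xy: "x < y"
  shows "integral {x..y} (R \<phi>) = c * (\<phi> y - \<phi> x)"
proof (rule antisym)
  have P: "profile \<phi>" using w by (simp add: wave_def)
  show "integral {x..y} (R \<phi>) \<le> c * (\<phi> y - \<phi> x)"
    using w xy by (simp add: wave_def weak_super_def)
  have "integral {- y..- x} (rhs \<mu>' f' (flip \<phi>)) \<le> - c * (flip \<phi> (- x) - flip \<phi> (- y))"
    using w xy by (simp add: wave_def weak_super_def)
  also have "integral {- y..- x} (rhs \<mu>' f' (flip \<phi>)) = - integral {x..y} (R \<phi>)"
    unfolding rhs_flip[OF P, abs_def] using integral_reflect_real[of y x "R \<phi>"] by simp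
  finally show "c * (\<phi> y - \<phi> x) \<le> integral {x..y} (R \<phi>)" by (simp add: flip_def algebra_simps)
qed

text \<open>Every integral of \<open>R \<phi>\<close> over an interval vanishes, so
  \<open>R \<phi>\<close> is 0 wherever \<open>\<phi>\<close> and its convolution are continuous.
  Both are monotone, so the exceptions are countable and invisible to the essential
  supremum.\<close>

lemma zero_speed_equation:
  assumes w: "wave 0 \<phi>"
  shows "AE x in lborel. R \<phi> x = 0"
proof -
  have P: "profile \<phi>" using w by (simp add: wave_def)
  let ?E = "{x. \<not> isCont \<phi> x} \<union> {x. \<not> isCont (conv \<mu> \<phi>) x}"
  have "countable ?E"
    using P conv_profile[OF P] by (intro countable_Un mono_ctble_discont) (auto simp: profile_def)
  moreover have "R \<phi> x = 0" if "x \<notin> ?E" for x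
  proof (rule ccontr)
    assume n: "R \<phi> x \<noteq> 0"
    have "isCont f (\<phi> x)" using f_cont by (simp add: continuous_on_eq_continuous_at)
    then have "isCont (R \<phi>) x"
      unfolding rhs_def[abs_def] using that by (auto intro!: continuous_intros isCont_o2[of x \<phi> f])
    then obtain d where d: "0 < d" "\<And>y. \<bar>y - x\<bar> < d \<Longrightarrow> \<bar>R \<phi> y - R \<phi> x\<bar> < \<bar>R \<phi> x\<bar> / 2"
      unfolding continuous_at_eps_delta dist_real_def using n by (metis half_gt_zero zero_less_abs_iff)
    let ?y = "x + d / 2"
    have near_x: "\<bar>R \<phi> s - R \<phi> x\<bar> < \<bar>R \<phi> x\<bar> / 2" if "s \<in> {x..?y}" for s
      using that d(1) by (intro d(2)) auto
    have z: "integral {x..?y} (R \<phi>) = 0" using wave_weak_equation[OF w, of x ?y] d by simp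
    show False
    proof (cases "0 < R \<phi> x")
      case True
      have "integral {x..?y} (\<lambda>_. R \<phi> x / 2) \<le> integral {x..?y} (R \<phi>)"
      proof (intro integral_le rhs_integrable_on[OF P])
        show "R \<phi> x / 2 \<le> R \<phi> s" if "s \<in> {x..?y}" for s using near_x[OF that] True by linarith
      qed auto
      then show False using z d True by (simp add: mult_le_0_iff)
    next
      case False
      have "integral {x..?y} (R \<phi>) \<le> integral {x..?y} (\<lambda>_. R \<phi> x / 2)"
      proof (intro integral_le rhs_integrable_on[OF P])
        show "R \<phi> s \<le> R \<phi> x / 2" if "s \<in> {x..?y}" for s using near_x[OF that] False by linarith
      qed auto
      then show False using z d False n by (simp add: zero_le_mult_iff)
    qed
  qed
  ultimately show ?thesis
    by (intro AE_I'[OF countable_imp_null_set_lborel[of ?E]]) auto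
qed

text \<open>For nonzero speed the weak equation makes \<open>\<phi>\<close> Lipschitz, hence also
  \<open>R \<phi>\<close>. The quotient is a mean of \<open>R \<phi>\<close> over an interval of
  length \<open>\<bar>c * h\<bar>\<close>, so the error is linear in \<open>h\<close> uniformly in
  \<open>y\<close>.\<close>

lemma wave_difference_quotient:
  assumes w: "wave c \<phi>" and c: "c \<noteq> 0"
  obtains K where "0 \<le> K" "\<And>y h. h \<noteq> 0 \<Longrightarrow> \<bar>(\<phi> (y + c * h) - \<phi> y) / h - R \<phi> y\<bar> \<le> K * \<bar>h\<bar>"
proof -
  have P: "profile \<phi>" using w by (simp add: wave_def)
  define K1 where "K1 = (1 + L) / \<bar>c\<bar>"
  \<comment> \<open>The three summands are Lipschitz constants of the convolution, of
    \<open>\<phi>\<close> and of \<open>f\<close> composed with \<open>\<phi>\<close>.\<close>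
  define K where "K = K1 + K1 + L * K1"
  have K0: "0 \<le> K1" "0 \<le> K" using L0 by (auto simp: K1_def K_def)
  have lip1: "\<bar>\<phi> y - \<phi> x\<bar> \<le> K1 * \<bar>y - x\<bar>" for x y
  proof -
    have "\<bar>\<phi> y - \<phi> x\<bar> \<le> K1 * \<bar>y - x\<bar>" if "x < y" for x y
    proof -
      have "\<bar>c\<bar> * \<bar>\<phi> y - \<phi> x\<bar> \<le> (1 + L) * (y - x)"
        using rhs_integral_bound[OF P, of x y] that unfolding wave_weak_equation[OF w that] abs_mult by simp
      then show ?thesis using c that by (simp add: K1_def field_simps)
    qed
    from this[of x y] this[of y x] show ?thesis by (cases x y rule: linorder_cases) (auto simp: abs_minus_commute)
  qed
  have lip2: "\<bar>conv \<mu> \<phi> y - conv \<mu> \<phi> x\<bar> \<le> K1 * \<bar>y - x\<bar>" for x y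
  proof -
    have "\<bar>conv \<mu> \<phi> y - conv \<mu> \<phi> x\<bar> = \<bar>\<integral>z. \<phi> (y - z) - \<phi> (x - z) \<partial>\<mu>\<bar>"
      unfolding conv_def by (subst Bochner_Integration.integral_diff) (auto simp: profile_integrable[OF P])
    also have "\<dots> \<le> (\<integral>z. \<bar>\<phi> (y - z) - \<phi> (x - z)\<bar> \<partial>\<mu>)" by (rule integral_abs_bound)
    also have "\<dots> \<le> (\<integral>z. K1 * \<bar>y - x\<bar> \<partial>\<mu>)"
    proof (rule integral_mono)
      show "\<bar>\<phi> (y - z) - \<phi> (x - z)\<bar> \<le> K1 * \<bar>y - x\<bar>" for z using lip1[of "y - z" "x - z"] by simp
    qed (use profile_integrable[OF P] in auto)
    finally show ?thesis using prob_space by simp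
  qed
  have lip3: "\<bar>R \<phi> y - R \<phi> x\<bar> \<le> K * \<bar>y - x\<bar>" for x y
  proof -
    have "\<bar>f (\<phi> y) - f (\<phi> x)\<bar> \<le> L * (K1 * \<bar>y - x\<bar>)"
      using lip[of "\<phi> y" "\<phi> x"] mult_left_mono[OF lip1[of y x] L0] by linarith
    then show ?thesis
      unfolding rhs_def K_def using lip1[of y x] lip2[of y x] by (simp add: distrib_right)
  qed
  \<comment> \<open>The reference point \<open>z\<close> is free so that it can be either endpoint,
    according to the sign of \<open>c * h\<close>.\<close>
  have inc: "\<bar>c * (\<phi> y - \<phi> x) - (y - x) * R \<phi> z\<bar> \<le> K * (y - x)\<^sup>2" if xy: "x < y" and z: "z \<in> {x..y}" for x y z
  proof -
    have b: "\<bar>R \<phi> s - R \<phi> z\<bar> \<le> K * (y - x)" if "s \<in> {x..y}" for s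
    proof -
      have "\<bar>R \<phi> s - R \<phi> z\<bar> \<le> K * \<bar>s - z\<bar>" by (rule lip3)
      also have "\<dots> \<le> K * (y - x)" using that z K0 by (intro mult_left_mono) auto
      finally show ?thesis .
    qed
    have "integral {x..y} (R \<phi>) \<le> integral {x..y} (\<lambda>_. R \<phi> z + K * (y - x))"
    proof (intro integral_le rhs_integrable_on[OF P])
      show "R \<phi> s \<le> R \<phi> z + K * (y - x)" if "s \<in> {x..y}" for s using b[OF that] by linarith
    qed auto
    moreover have "integral {x..y} (\<lambda>_. R \<phi> z - K * (y - x)) \<le> integral {x..y} (R \<phi>)"
    proof (intro integral_le rhs_integrable_on[OF P])
      show "R \<phi> z - K * (y - x) \<le> R \<phi> s" if "s \<in> {x..y}" for s using b[OF that] by linarith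
    qed auto
    ultimately show ?thesis
      unfolding wave_weak_equation[OF w xy] using xy by (simp add: abs_le_iff power2_eq_square algebra_simps)
  qed
  have "\<bar>(\<phi> (y + c * h) - \<phi> y) / h - R \<phi> y\<bar> \<le> K * \<bar>c\<bar> * \<bar>h\<bar>" if h: "h \<noteq> 0" for y h
  proof -
    define d where "d = c * h"
    have d: "d \<noteq> 0" using c h by (simp add: d_def)
    have "\<bar>c * (\<phi> (y + d) - \<phi> y) - d * R \<phi> y\<bar> \<le> K * d\<^sup>2"
    proof (cases "0 < d")
      case True
      then show ?thesis using inc[of y "y + d" y] by simp
    next
      case False
      then have "\<bar>c * (\<phi> y - \<phi> (y + d)) - (- d) * R \<phi> y\<bar> \<le> K * (- d)\<^sup>2"
        using inc[of "y + d" y y] d by simp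
      moreover have "c * (\<phi> y - \<phi> (y + d)) - (- d) * R \<phi> y = - (c * (\<phi> (y + d) - \<phi> y) - d * R \<phi> y)"
        by (simp add: algebra_simps)
      ultimately show ?thesis by (simp only: abs_minus_cancel power2_minus)
    qed
    moreover have "c * (\<phi> (y + d) - \<phi> y) - d * R \<phi> y = d * ((\<phi> (y + d) - \<phi> y) / h - R \<phi> y)"
      using h by (simp add: d_def field_simps)
    moreover have "K * d\<^sup>2 = \<bar>d\<bar> * (K * \<bar>d\<bar>)" by (simp add: power2_eq_square)
    ultimately have "\<bar>d\<bar> * \<bar>(\<phi> (y + d) - \<phi> y) / h - R \<phi> y\<bar> \<le> \<bar>d\<bar> * (K * \<bar>d\<bar>)" by (simp add: abs_mult)
    then have "\<bar>(\<phi> (y + d) - \<phi> y) / h - R \<phi> y\<bar> \<le> K * \<bar>d\<bar>" using d by simp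
    then show ?thesis by (simp add: d_def abs_mult mult.assoc)
  qed
  then show thesis using that[of "K * \<bar>c\<bar>"] K0 by auto
qed

lemma Linf_norm_le:
  assumes [measurable]: "g \<in> borel_measurable borel" and "AE x in lborel. \<bar>g x\<bar> \<le> B"
  shows "0 \<le> Linf_norm g" "Linf_norm g \<le> ereal B"
proof -
  have "esssup lborel (\<lambda>_::real. 0::ereal) \<le> Linf_norm g"
    unfolding Linf_norm_def by (rule esssup_mono) auto
  moreover have "esssup lborel (\<lambda>_::real. 0::ereal) = 0" by (rule esssup_const) simp
  ultimately show "0 \<le> Linf_norm g" by simp
  show "Linf_norm g \<le> ereal B"
    unfolding Linf_norm_def by (rule esssup_I) (use assms(2) in auto)
qed

lemma wave_is_solution:
  assumes w: "wave c \<phi>"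
  shows "is_solution \<mu> f (\<lambda>t x. \<phi> (x + c * t))"
proof -
  have P: "profile \<phi>" using w by (simp add: wave_def)
  note [measurable] = profile_measurable[OF P] profile_measurable[OF conv_profile[OF P]]
  have bd: "bounded (range (\<lambda>x. \<phi> (x + c * t)))" for t
    using profileD[OF P] by (intro boundedI[of _ 1]) auto
  define E where "E t h x = (\<phi> (x + c * (t + h)) - \<phi> (x + c * t)) / h
      - (conv \<mu> (\<lambda>x. \<phi> (x + c * t)) x - \<phi> (x + c * t) + f (\<phi> (x + c * t)))" for t h x
  have E: "E t h x = (\<phi> ((x + c * t) + c * h) - \<phi> (x + c * t)) / h - R \<phi> (x + c * t)" for t h x
    unfolding E_def rhs_def conv_def by (simp add: algebra_simps)
  have Em: "E t h \<in> borel_measurable borel" for t h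
    unfolding E[abs_def] using rhs_measurable[OF P] by measurable
  obtain K where K: "\<And>t h. h \<noteq> 0 \<Longrightarrow> AE x in lborel. \<bar>E t h x\<bar> \<le> K * \<bar>h\<bar>"
  proof (cases "c = 0")
    \<comment> \<open>At speed 0 the difference quotient vanishes and the error is
      \<open>- R \<phi>\<close>, zero almost everywhere.\<close>
    case True
    have "AE x in lborel. \<bar>E t h x\<bar> \<le> 0 * \<bar>h\<bar>" for t h
      using zero_speed_equation w True by (auto simp: E)
    then show thesis using that by blast
  next
    case False
    then obtain K where K: "\<And>y h. h \<noteq> 0 \<Longrightarrow> \<bar>(\<phi> (y + c * h) - \<phi> y) / h - R \<phi> y\<bar> \<le> K * \<bar>h\<bar>"
      by (rule wave_difference_quotient[OF w]) blast
    have "AE x in lborel. \<bar>E t h x\<bar> \<le> K * \<bar>h\<bar>" if "h \<noteq> 0" for t h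
      unfolding E by (intro always_eventually allI K that)
    then show thesis using that by blast
  qed
  have "((\<lambda>h. Linf_norm (E t h)) \<longlongrightarrow> 0) (at 0)" for t
  proof (rule tendsto_sandwich)
    show "\<forall>\<^sub>F h in at 0. 0 \<le> Linf_norm (E t h)" "\<forall>\<^sub>F h in at 0. Linf_norm (E t h) \<le> ereal (K * \<bar>h\<bar>)"
      using Linf_norm_le[OF Em K] by (auto simp: eventually_at_filter)
    have "((\<lambda>h. K * \<bar>h\<bar>) \<longlongrightarrow> K * \<bar>0\<bar>) (at 0)" by (intro tendsto_intros)
    then show "((\<lambda>h. ereal (K * \<bar>h\<bar>)) \<longlongrightarrow> 0) (at 0)" by (simp add: zero_ereal_def)
  qed simp
  then show ?thesis
    unfolding is_solution_def using bd by (auto simp: E_def[abs_def])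
qed

end

theorem theorem1:
  fixes \<mu> :: "real measure" and f :: "real \<Rightarrow> real" and \<alpha> :: real
  assumes "sets \<mu> = sets borel"
    and "emeasure \<mu> UNIV = 1"
    and "\<forall>x. f differentiable (at x)"
    and "continuous_on UNIV (deriv f)"
    and "\<exists>L. L-lipschitz_on UNIV f"
    and "0 < \<alpha>" and "\<alpha> < 1"
    and "f 0 = 0" and "f \<alpha> = 0" and "f 1 = 0"
    and "\<forall>x\<in>{0<..<\<alpha>}. f x < 0"
    and "\<forall>x\<in>{\<alpha><..<1}. f x > 0"
    and "deriv f \<alpha> > 0"
  shows "\<exists>c::real. \<exists>\<phi>::real \<Rightarrow> real.
           (mono \<phi> \<or> antimono \<phi>) \<and> (\<phi> \<longlongrightarrow> 0) at_bot \<and> (\<phi> \<longlongrightarrow> 1) at_top \<and>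
           is_solution \<mu> f (\<lambda>t x. \<phi> (x + c * t))"
proof -
  have "space \<mu> = UNIV" using sets_eq_imp_space_eq[OF assms(1)] by simp
  then have prob: "prob_space \<mu>" using assms(2) by (intro prob_spaceI) simp
  obtain L where L: "L-lipschitz_on UNIV f" using assms(5) by blast
  \<comment> \<open>Half the derivative leaves room for a strict bound on nearby difference
    quotients.\<close>
  define \<kappa> where "\<kappa> = deriv f \<alpha> / 2"
  have k: "0 < \<kappa>" "\<kappa> < deriv f \<alpha>" using assms(13) by (auto simp: \<kappa>_def)
  have "(f has_real_derivative deriv f \<alpha>) (at \<alpha>)"
    using assms(3) by (simp add: DERIV_deriv_iff_real_differentiable)
  then have "((\<lambda>h. (f (\<alpha> + h) - f \<alpha>) / h) \<longlongrightarrow> deriv f \<alpha>) (at 0)" by (simp add: DERIV_def)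
  then have "\<forall>\<^sub>F h in at 0. \<kappa> < (f (\<alpha> + h) - f \<alpha>) / h" using k by (intro order_tendstoD)
  then obtain d where d: "0 < d" "\<And>h. h \<noteq> 0 \<Longrightarrow> \<bar>h\<bar> < d \<Longrightarrow> \<kappa> < f (\<alpha> + h) / h"
    using assms(9) by (auto simp: eventually_at)
  have unstable: "\<kappa> * (u - \<alpha>)\<^sup>2 \<le> f u * (u - \<alpha>)" if "\<bar>u - \<alpha>\<bar> \<le> d / 2" for u
  proof (cases "u = \<alpha>")
    case False
    then have "\<kappa> < f u / (u - \<alpha>)" using d(2)[of "u - \<alpha>"] that d(1) by simp
    then have "\<kappa> * (u - \<alpha>)\<^sup>2 \<le> f u / (u - \<alpha>) * (u - \<alpha>)\<^sup>2" by (intro mult_right_mono) auto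
    also have "\<dots> = f u * (u - \<alpha>)" using False by (simp add: power2_eq_square)
    finally show ?thesis .
  qed simp
  \<comment> \<open>Halving \<open>d\<close> fits the closed neighbourhood of the locale into the
    open one where the bound holds.\<close>
  interpret bistable \<mu> f \<alpha> L \<kappa> "d / 2"
  proof (rule bistable.intro)
    show "\<bar>f u - f v\<bar> \<le> L * \<bar>u - v\<bar>" for u v
      using lipschitz_onD[OF L, of u v] by (simp add: dist_real_def)
    show "0 \<le> L" by (rule lipschitz_on_nonneg[OF L])
  qed (use assms prob k d unstable in auto)
  obtain c \<phi> where w: "wave c \<phi>" using wave_exists by blast
  then have "mono \<phi>" "(\<phi> \<longlongrightarrow> 0) at_bot" "(\<phi> \<longlongrightarrow> 1) at_top" by (auto simp: wave_def profile_def)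
  then show ?thesis using wave_is_solution[OF w] by blast
qed

end
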